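(* Let $G=\mathbb{Z}/p\mathbb{Z}$ with $p$ an odd prime. Let $V$ be a finite-dimensional representation of $G$ over a field $\mathbf{k}$ with $\operatorname{char}\mathbf{k}\neq p$, in which exactly two distinct nontrivial characters of $G$ occur. Then the degrees of the points of the lattice $L(G,\operatorname{Supp}'V)\subset\mathbb{Z}^2$ contained in $$T:=\{(a_1,a_2):0\leq a_1,a_2<p\}$$ are all distinct, and the set $D$ of nonzero degrees among them is contained in $\{2,3,\dots,2p-2\}$ and satisfies the following three properties: 1. $D$ is stable under the substitution $d\mapsto 2p-d$. 2. There is exactly one element of $D$ in each nonzero residue class mod $p$, and $p\notin D$. 3. For every $d\in D$, there is no element of $D$ congruent to $p$ modulo $d$. In particular, if furthermore $\dim_{\mathbf{k}}V=2$, then the Hilbert series of the invariant ring $\mathbf{k}[V]^G$ has the form $$H(\mathbf{k}[V]^G,t)=\frac{1+\sum_{d\in D}t^d}{(1-t^p)^2},$$ where $D$ is the set of nonzero degrees of the points of $L(G,\operatorname{Supp}'V)$ contained in $T$.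
   Context: $\mathbf{k}[V]$ is the ring of polynomial functions on $V$, graded by degree, with $G$ acting by $(gf)(v)=f(g^{-1}v)$; $\mathbf{k}[V]^G$ is the (graded) ring of invariants. Characters occurring in $V$ or $V^*$ are those occurring after base change to an extension field $\mathbf{K}\supseteq\mathbf{k}$ containing the $p$th roots of unity. $\operatorname{Supp}'V=\{\chi_1,\chi_2\}$ is the set of distinct nontrivial characters occurring in $V^*$, and $$L(G,\operatorname{Supp}'V)=\{(a_1,a_2)\in\mathbb{Z}^2:\chi_1^{a_1}\chi_2^{a_2}=1\}.$$ The degree of a point $(a_1,a_2)$ with nonnegative coordinates is $a_1+a_2$. *)

theory Defs
  imports
    "HOL-Analysis.Analysis"
    "HOL-Algebra.Elementary_Groups"
    "HOL-Computational_Algebra.Computational_Algebra"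
    "HOL-Number_Theory.Cong"
    "HOL-Library.Poly_Mapping"
begin

section \<open>Representations and characters of \<open>\<int>/p\<int>\<close>\<close>

definition GL :: "('k::field ^ 'n ^ 'n) monoid" where
  "GL = \<lparr>carrier = {A. invertible A}, monoid.mult = (**), one = mat 1\<rparr>"

definition Kunits :: "('K::field) monoid" where
  "Kunits = \<lparr>carrier = UNIV - {0}, monoid.mult = (*), one = 1\<rparr>"

definition is_representation :: "nat \<Rightarrow> (int \<Rightarrow> 'k::field ^ 'n ^ 'n) \<Rightarrow> bool" where
  "is_representation p \<rho> \<longleftrightarrow> \<rho> \<in> hom (integer_mod_group p) GL"

text \<open>The group acts on $V = k^n$ by \<open>\<rho> g *v v\<close> and on column vectors of coordinates
  with respect to the dual basis of $V^*$ by the inverse transpose.\<close>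

definition dual_rep :: "nat \<Rightarrow> (int \<Rightarrow> 'k::field ^ 'n ^ 'n) \<Rightarrow> int \<Rightarrow> 'k ^ 'n ^ 'n" where
  "dual_rep p \<rho> g = transpose (\<rho> (inv\<^bsub>integer_mod_group p\<^esub> g))"

definition field_embedding :: "('k::field \<Rightarrow> 'K::field) \<Rightarrow> bool" where
  "field_embedding \<iota> \<longleftrightarrow>
     \<iota> 1 = 1 \<and> (\<forall>x y. \<iota> (x + y) = \<iota> x + \<iota> y) \<and> (\<forall>x y. \<iota> (x * y) = \<iota> x * \<iota> y)"

text \<open>Characters are required to be extensional, so that equality of functions is equality
  of characters.\<close>

definition characters :: "nat \<Rightarrow> (int \<Rightarrow> 'K::field) set" where
  "characters p = hom (integer_mod_group p) Kunits \<inter> extensional (carrier (integer_mod_group p))"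

definition trivial_character :: "nat \<Rightarrow> int \<Rightarrow> 'K::field" where
  "trivial_character p = (\<lambda>g\<in>carrier (integer_mod_group p). 1)"

text \<open>\<open>chi\<close> occurs in $k^n \otimes_k K$, where \<open>\<iota>\<close> is the inclusion of $k$ into $K$.\<close>

definition occurs ::
    "nat \<Rightarrow> ('k::field \<Rightarrow> 'K::field) \<Rightarrow> (int \<Rightarrow> 'k ^ 'n ^ 'n) \<Rightarrow> (int \<Rightarrow> 'K) \<Rightarrow> bool" where
  "occurs p \<iota> \<rho> chi \<longleftrightarrow>
     (\<exists>v :: 'K ^ 'n. v \<noteq> 0 \<and>
        (\<forall>g\<in>carrier (integer_mod_group p). map_matrix \<iota> (\<rho> g) *v v = chi g *s v))"

definition nontrivial_characters_in ::
    "nat \<Rightarrow> ('k::field \<Rightarrow> 'K::field) \<Rightarrow> (int \<Rightarrow> 'k ^ 'n ^ 'n) \<Rightarrow> (int \<Rightarrow> 'K) set" where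
  "nontrivial_characters_in p \<iota> \<rho> =
     {chi \<in> characters p. chi \<noteq> trivial_character p \<and> occurs p \<iota> \<rho> chi}"

definition Supp' ::
    "nat \<Rightarrow> ('k::field \<Rightarrow> 'K::field) \<Rightarrow> (int \<Rightarrow> 'k ^ 'n ^ 'n) \<Rightarrow> (int \<Rightarrow> 'K) set" where
  "Supp' p \<iota> \<rho> = nontrivial_characters_in p \<iota> (dual_rep p \<rho>)"

section \<open>The lattice\<close>

definition lattice_L :: "nat \<Rightarrow> (int \<Rightarrow> 'K::field) \<Rightarrow> (int \<Rightarrow> 'K) \<Rightarrow> (int \<times> int) set" where
  "lattice_L p chi1 chi2 =
     {(a\<^sub>1, a\<^sub>2). \<forall>g\<in>carrier (integer_mod_group p). chi1 g powi a\<^sub>1 * chi2 g powi a\<^sub>2 = 1}"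

definition box_T :: "nat \<Rightarrow> (int \<times> int) set" where
  "box_T p = {(a\<^sub>1, a\<^sub>2). 0 \<le> a\<^sub>1 \<and> a\<^sub>1 < int p \<and> 0 \<le> a\<^sub>2 \<and> a\<^sub>2 < int p}"

definition point_deg :: "int \<times> int \<Rightarrow> int" where
  "point_deg a = fst a + snd a"

definition nonzero_degrees :: "nat \<Rightarrow> (int \<Rightarrow> 'K::field) \<Rightarrow> (int \<Rightarrow> 'K) \<Rightarrow> int set" where
  "nonzero_degrees p chi1 chi2 = point_deg ` (lattice_L p chi1 chi2 \<inter> box_T p) - {0}"

section \<open>The invariant ring and its Hilbert series\<close>

text \<open>$k[V]$ is the symmetric algebra of $V^*$, i.e. the ring of formal polynomials in the
  coordinates of $V$; over a finite field these are not determined by their values on $V$.\<close>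

type_synonym ('n, 'k) coord_ring = "('n \<Rightarrow>\<^sub>0 nat) \<Rightarrow>\<^sub>0 'k"

definition const :: "'k::field \<Rightarrow> ('n, 'k) coord_ring" where
  "const c = Poly_Mapping.single 0 c"

definition coord :: "'n \<Rightarrow> ('n, 'k::field) coord_ring" where
  "coord i = Poly_Mapping.single (Poly_Mapping.single i 1) 1"

definition scale_poly :: "'k::field \<Rightarrow> ('n, 'k) coord_ring \<Rightarrow> ('n, 'k) coord_ring" where
  "scale_poly c f = const c * f"

lemma vector_space_scale_poly: "vector_space scale_poly"
  by unfold_locales
    (simp_all add: scale_poly_def const_def algebra_simps single_add mult_single)

text \<open>The polynomial \<open>v \<mapsto> f (A *v v)\<close>.\<close>

definition subst_linear ::
    "'k::field ^ 'n ^ 'n \<Rightarrow> ('n::finite, 'k) coord_ring \<Rightarrow> ('n, 'k) coord_ring" where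
  "subst_linear A f =
     (\<Sum>m\<in>Poly_Mapping.keys f. const (Poly_Mapping.lookup f m) *
        (\<Prod>i\<in>UNIV. (\<Sum>j\<in>UNIV. const (A $ i $ j) * coord j) ^ Poly_Mapping.lookup m i))"

definition poly_action ::
    "nat \<Rightarrow> (int \<Rightarrow> 'k::field ^ 'n ^ 'n) \<Rightarrow> int \<Rightarrow>
      ('n::finite, 'k) coord_ring \<Rightarrow> ('n, 'k) coord_ring" where
  "poly_action p \<rho> g f = subst_linear (\<rho> (inv\<^bsub>integer_mod_group p\<^esub> g)) f"

definition invariant_ring ::
    "nat \<Rightarrow> (int \<Rightarrow> 'k::field ^ 'n ^ 'n) \<Rightarrow> ('n::finite, 'k) coord_ring set" where
  "invariant_ring p \<rho> = {f. \<forall>g\<in>carrier (integer_mod_group p). poly_action p \<rho> g f = f}"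

definition homogeneous :: "nat \<Rightarrow> ('n::finite, 'k::field) coord_ring set" where
  "homogeneous d =
     {f. \<forall>m\<in>Poly_Mapping.keys f. (\<Sum>i\<in>UNIV. Poly_Mapping.lookup m i) = d}"

definition hilbert_series :: "('n::finite, 'k::field) coord_ring set \<Rightarrow> rat fps" where
  "hilbert_series R =
     Abs_fps (\<lambda>d. of_nat (vector_space.dim scale_poly (R \<inter> homogeneous d)))"

end

theory Submission
  imports Defs
begin

text \<open>
  If \<open>u\<close> and \<open>u\<^sup>b\<close> are the values of the two characters at the generator, the lattice consists of
  the \<open>(x, y)\<close> with \<open>p\<close> dividing \<open>x + b y\<close>, where \<open>b\<close> is congruent neither to \<open>0\<close> nor to \<open>1\<close>
  modulo \<open>p\<close>. Hence \<open>x + y \<equiv> (1 - b) y\<close> takes every residue exactly once on the box. If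
  \<open>d, e \<in> D\<close> and \<open>e = p + k d\<close>, one may assume \<open>k > 0\<close> by the symmetry \<open>d \<mapsto> 2p - d\<close>; then \<open>k\<close> times
  the point of degree \<open>d\<close> lies in the box, since its degree is less than \<open>p\<close>, so \<open>k d\<close> and \<open>e\<close> are
  distinct congruent elements of \<open>D\<close>.

  The dimension of the space of invariants of given degree does not change under extension of
  scalars, as one sees by applying the coordinate functionals of \<open>K\<close> over the base field to the coefficients.
  Over \<open>K\<close> the action is diagonal in a basis of eigenvectors of \<open>V\<^sup>*\<close>, so the invariants are
  spanned by the monomials with exponents in the lattice. The lattice is stable under translation
  by \<open>(p, 0)\<close> and \<open>(0, p)\<close>, which accounts for the denominator.
\<close>

no_notation fps_nth (infixl \<open>$\<close> 75)

section \<open>Degrees of lattice points\<close>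

definition cyclic_lattice :: "nat \<Rightarrow> int \<Rightarrow> (int \<times> int) set" where
  "cyclic_lattice p b = {(x, y). int p dvd x + b * y}"

lemma dvd_abs_less_imp_zero:
  fixes a m :: int
  assumes "m dvd a" "\<bar>a\<bar> < m"
  shows "a = 0"
  using dvd_imp_le_int[of a m] assms by linarith

text \<open>Subtracting the congruences for \<open>x + b * y\<close> and \<open>x + y\<close> leaves
  \<open>(1 - b) * (y - y')\<close>. Since \<open>1 - b\<close> is a unit modulo \<open>p\<close>,
  this fixes \<open>y\<close> and then \<open>x\<close> modulo \<open>p\<close>, and points of the
  box are determined by their residues.\<close>

lemma cyclic_lattice_eqI:
  assumes "prime p" "\<not> int p dvd 1 - b"
    and "u \<in> cyclic_lattice p b \<inter> box_T p" "v \<in> cyclic_lattice p b \<inter> box_T p"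
    and "[point_deg u = point_deg v] (mod int p)"
  shows "u = v"
proof -
  obtain x y x' y' where uv: "u = (x, y)" "v = (x', y')" by fastforce
  have P: "prime (int p)" using assms(1) by simp
  have 1: "int p dvd (x - x') + b * (y - y')"
    using assms(3,4) dvd_diff[of "int p" "x + b * y" "x' + b * y'"]
    by (simp add: uv cyclic_lattice_def algebra_simps)
  have 2: "int p dvd (x - x') + (y - y')"
    using assms(5) by (simp add: uv point_deg_def cong_iff_dvd_diff algebra_simps)
  have "int p dvd (1 - b) * (y - y')"
    using dvd_diff[OF 2 1] by (simp add: algebra_simps)
  then have 3: "int p dvd y - y'" using P assms(2) prime_dvd_mult_iff by blast
  then have 4: "int p dvd x - x'" using 2 dvd_add_left_iff by blast
  have "y = y'" using dvd_abs_less_imp_zero[OF 3] assms(3,4) by (auto simp: uv box_T_def)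
  moreover have "x = x'" using dvd_abs_less_imp_zero[OF 4] assms(3,4) by (auto simp: uv box_T_def)
  ultimately show ?thesis by (simp add: uv)
qed

text \<open>Inverting \<open>1 - b\<close> modulo \<open>p\<close> solves
  \<open>x + b * y = 0\<close> and \<open>x + y = r\<close> by \<open>y = r / (1 - b)\<close> and
  \<open>x = - b * y\<close>; reduction modulo \<open>p\<close> moves the solution into the
  box.\<close>

lemma ex_cyclic_lattice_degree_cong:
  assumes "prime p" "\<not> int p dvd 1 - b"
  shows "\<exists>u\<in>cyclic_lattice p b \<inter> box_T p. [point_deg u = r] (mod int p)"
proof -
  have P: "prime (int p)" and p0: "int p > 0" using assms(1) prime_gt_0_nat by auto
  have "coprime (1 - b) (int p)"
    using P assms(2) by (simp add: coprime_commute prime_imp_coprime)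
  then obtain z where z: "[(1 - b) * z = 1] (mod int p)"
    using cong_solve_coprime_int by blast
  define y where "y = (z * r) mod int p"
  define x where "x = (- b * y) mod int p"
  have 1: "[y = z * r] (mod int p)" and 2: "[x = - b * y] (mod int p)"
    by (simp_all add: x_def y_def cong_def)
  have "[x + b * y = - b * y + b * y] (mod int p)" by (intro cong_add 2 cong_refl)
  then have "int p dvd x + b * y" by (simp add: cong_0_iff)
  moreover have "[x + y = - b * y + y] (mod int p)" by (intro cong_add 2 cong_refl)
  moreover have "- b * y + y = (1 - b) * y" by (simp add: algebra_simps)
  moreover have "[(1 - b) * y = (1 - b) * (z * r)] (mod int p)" by (intro cong_mult 1 cong_refl)
  moreover have "[(1 - b) * z * r = 1 * r] (mod int p)" by (intro cong_mult z cong_refl)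
  ultimately have "(x, y) \<in> cyclic_lattice p b" "[x + y = r] (mod int p)"
    by (auto simp: cyclic_lattice_def mult.assoc intro: cong_trans)
  moreover have "(x, y) \<in> box_T p"
    using p0 by (simp add: box_T_def x_def y_def)
  ultimately show ?thesis
    by (intro bexI[of _ "(x, y)"]) (simp_all add: point_deg_def)
qed

lemma cyclic_lattice_scale:
  "(x, y) \<in> cyclic_lattice p b \<Longrightarrow> (k * x, k * y) \<in> cyclic_lattice p b"
  by (auto simp: cyclic_lattice_def algebra_simps dest: dvd_mult[of _ _ k])

lemma cyclic_lattice_degrees:
  fixes p :: nat and b :: int
  defines "T \<equiv> cyclic_lattice p b \<inter> box_T p"
  defines "D \<equiv> point_deg ` T - {0}"
  assumes p: "prime p" and b: "\<not> int p dvd b" "\<not> int p dvd 1 - b"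
  shows "inj_on point_deg T"
    and "D \<subseteq> {2..2 * int p - 2}"
    and "\<And>d. d \<in> D \<Longrightarrow> 2 * int p - d \<in> D"
    and "\<And>r. r \<in> {1..<int p} \<Longrightarrow> \<exists>!d. d \<in> D \<and> [d = r] (mod int p)"
    and "int p \<notin> D"
    and "\<And>d e. d \<in> D \<Longrightarrow> e \<in> D \<Longrightarrow> \<not> [e = int p] (mod d)"
proof -
  have P: "prime (int p)" and p0: "int p > 0" using p prime_gt_0_nat by auto
  have eqI: "u = v" if "u \<in> T" "v \<in> T" "[point_deg u = point_deg v] (mod int p)" for u v
    using cyclic_lattice_eqI[OF p b(2)] that by (simp add: T_def)
  have zero: "(0, 0) \<in> T" using p0 by (simp add: T_def cyclic_lattice_def box_T_def)
  \<comment> \<open>Since \<open>b\<close> is a unit modulo \<open>p\<close>, both coordinates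
    vanish modulo \<open>p\<close> as soon as one does. Hence a lattice point of the box other than
    the origin has two positive coordinates, which gives the bounds on the degrees.\<close>
  have dvd_iff: "int p dvd x \<longleftrightarrow> int p dvd y" if "(x, y) \<in> T" for x y
  proof -
    have "int p dvd x + b * y" using that by (simp add: T_def cyclic_lattice_def)
    then have "int p dvd x \<longleftrightarrow> int p dvd b * y"
      by (metis dvd_add_left_iff dvd_add_right_iff)
    then show ?thesis using P b(1) by (simp add: prime_dvd_mult_iff)
  qed
  have pos: "0 < x \<and> x < int p \<and> 0 < y \<and> y < int p" if "(x, y) \<in> T" "x + y \<noteq> 0" for x y
  proof -
    have "0 \<le> x" "x < int p" "0 \<le> y" "y < int p" using that by (auto simp: T_def box_T_def)
    moreover from this have "x = 0 \<longleftrightarrow> int p dvd x" "y = 0 \<longleftrightarrow> int p dvd y"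
      using dvd_abs_less_imp_zero[of "int p" x] dvd_abs_less_imp_zero[of "int p" y] by auto
    ultimately show ?thesis using that dvd_iff[OF that(1)] by auto
  qed
  have DE: "\<exists>x y. (x, y) \<in> T \<and> x + y = d \<and> 0 < x \<and> x < int p \<and> 0 < y \<and> y < int p"
    if d: "d \<in> D" for d
  proof -
    obtain u where "u \<in> T" "d = point_deg u" "d \<noteq> 0"
      using d unfolding D_def by blast
    then show ?thesis using pos[of "fst u" "snd u"]
      by (intro exI[of _ "fst u"] exI[of _ "snd u"]) (simp add: point_deg_def)
  qed
  have DI: "x + y \<in> D" if "(x, y) \<in> T" "x + y \<noteq> 0" for x y
    using that imageI[of "(x, y)" T point_deg] by (simp add: D_def point_deg_def)
  show "inj_on point_deg T"
    using eqI by (simp add: inj_on_def)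
  show "D \<subseteq> {2..2 * int p - 2}"
  proof
    fix d assume "d \<in> D"
    then show "d \<in> {2..2 * int p - 2}" using DE[of d] by auto
  qed
  show stable: "2 * int p - d \<in> D" if d: "d \<in> D" for d
  proof -
    obtain x y where xy: "(x, y) \<in> T" "x + y = d" "0 < x" "x < int p" "0 < y" "y < int p"
      using DE[OF d] by blast
    \<comment> \<open>The lattice contains \<open>(p, p)\<close>, so it is stable under the
      reflection taking \<open>(x, y)\<close> to \<open>(p - x, p - y)\<close>. Positive coordinates
      keep the image inside the half-open box.\<close>
    have "int p dvd int p + b * int p - (x + b * y)"
      using xy(1) by (intro dvd_diff) (simp_all add: T_def cyclic_lattice_def)
    moreover have "int p + b * int p - (x + b * y) = (int p - x) + b * (int p - y)"
      by (simp add: algebra_simps)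
    ultimately have "(int p - x, int p - y) \<in> T"
      using xy by (simp add: T_def cyclic_lattice_def box_T_def)
    from DI[OF this] have "(int p - x) + (int p - y) \<in> D" using xy by linarith
    moreover have "(int p - x) + (int p - y) = 2 * int p - d" using xy(2) by simp
    ultimately show ?thesis by simp
  qed
  have uniq: "d = e" if de: "d \<in> D" "e \<in> D" "[d = e] (mod int p)" for d e
  proof -
    obtain u v where "u \<in> T" "d = point_deg u" "v \<in> T" "e = point_deg v"
      using de unfolding D_def by blast
    then show ?thesis using eqI[of u v] de(3) by simp
  qed
  have not_dvd: "\<not> int p dvd d" if d: "d \<in> D" for d
  proof (rule notI)
    assume "int p dvd d"
    obtain u where u: "u \<in> T" "point_deg u = d" "d \<noteq> 0" using d unfolding D_def by blast
    have "u = (0, 0)"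
      using \<open>int p dvd d\<close> u eqI[OF u(1) zero] by (simp add: point_deg_def cong_0_iff)
    then show False using u by (simp add: point_deg_def)
  qed
  show pD: "int p \<notin> D" using not_dvd[of "int p"] by auto
  show "\<exists>!d. d \<in> D \<and> [d = r] (mod int p)" if r: "r \<in> {1..<int p}" for r
  proof -
    obtain u where u: "u \<in> T" "[point_deg u = r] (mod int p)"
      using ex_cyclic_lattice_degree_cong[OF p b(2)] unfolding T_def by blast
    have "point_deg u \<noteq> 0"
    proof
      assume "point_deg u = 0"
      then have "int p dvd r" using u(2) by (simp add: cong_0_iff cong_sym_eq[of 0])
      then show False using r dvd_abs_less_imp_zero[of "int p" r] by auto
    qed
    then have "point_deg u \<in> D" using u(1) by (simp add: D_def)
    moreover have "d = point_deg u" if "d \<in> D \<and> [d = r] (mod int p)" for d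
      using that u(2) \<open>point_deg u \<in> D\<close> by (intro uniq) (auto intro: cong_trans cong_sym)
    ultimately show ?thesis using u(2) by blast
  qed
  have no_multiple: "e \<noteq> int p + k * d" if d: "d \<in> D" and e: "e \<in> D" and k: "0 < k" for d e k
  proof
    assume eq: "e = int p + k * d"
    obtain x y where xy: "(x, y) \<in> T" "x + y = d" "0 < x" "x < int p" "0 < y" "y < int p"
      using DE[OF d] by blast
    \<comment> \<open>From \<open>e < 2 * p\<close> follows \<open>k * d = e - p < p\<close>, so
      \<open>k\<close> times the point of degree \<open>d\<close> is still in the box.\<close>
    have "k * x + k * y < int p"
    proof -
      have "e < 2 * int p" using DE[OF e] by auto
      then show ?thesis using eq xy(2) by (simp flip: distrib_left)
    qed
    moreover have kpos: "0 < k * x" "0 < k * y" using k xy by simp_all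
    ultimately have "(k * x, k * y) \<in> T"
      using xy(1) cyclic_lattice_scale by (auto simp: T_def box_T_def)
    then have "k * x + k * y \<in> D" using DI kpos by simp
    then have "k * d \<in> D" using xy(2) by (simp flip: distrib_left)
    moreover have "[k * d = e] (mod int p)" by (simp add: eq cong_def)
    ultimately have "k * d = e" using e uniq by blast
    then show False using eq p0 by simp
  qed
  show "\<not> [e = int p] (mod d)" if d: "d \<in> D" and e: "e \<in> D" for d e
  proof
    assume "[e = int p] (mod d)"
    then obtain k where k: "e - int p = d * k" by (auto simp: cong_iff_dvd_diff)
    \<comment> \<open>Here \<open>e = p + d * k\<close>. The case \<open>k = 0\<close> would put
      \<open>p\<close> into \<open>D\<close>; for negative \<open>k\<close> the reflected degree is
      \<open>2 * p - e = p + (- k) * d\<close>, with a positive multiplier.\<close>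
    consider "k > 0" | "k = 0" | "- k > 0" by linarith
    then show False
    proof cases
      case 1
      then show False using no_multiple[OF d e 1] k by (simp add: algebra_simps)
    next
      case 2
      then show False using e k pD by simp
    next
      case 3
      then show False using no_multiple[OF d stable[OF e] 3] k by (simp add: algebra_simps)
    qed
  qed
qed

section \<open>Generating functions of sets of exponent pairs\<close>

definition degree_series :: "(nat \<times> nat) set \<Rightarrow> rat fps" where
  "degree_series S = Abs_fps (\<lambda>d. of_nat (card {a \<in> S. fst a + snd a = d}))"

lemma finite_degree_fiber: "finite {a \<in> S. fst a + snd a = (d::nat)}"
  by (rule finite_subset[of _ "{..d} \<times> {..d}"]) auto

text \<open>Splitting \<open>S\<close> into \<open>U\<close> and the image of \<open>f\<close> gives
  \<open>S(t) = U(t) + t^p S(t)\<close> for the generating functions.\<close>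

lemma degree_series_translate:
  assumes U: "U \<subseteq> S" and inj: "inj f" and img: "f ` S = S - U"
    and deg: "\<And>a. fst (f a) + snd (f a) = fst a + snd a + p"
  shows "degree_series U = degree_series S * (1 - fps_X ^ p)"
proof -
  have "fps_nth (degree_series S) d =
    fps_nth (degree_series U) d + fps_nth (fps_X ^ p * degree_series S) d" for d
  proof -
    let ?F = "\<lambda>S. {a \<in> S. fst a + snd a = d}"
    have "?F S = ?F U \<union> ?F (S - U)" using U by auto
    moreover have "card (?F U \<union> ?F (S - U)) = card (?F U) + card (?F (S - U))"
      by (rule card_Un_disjoint[OF finite_degree_fiber finite_degree_fiber]) auto
    moreover have "card (?F (S - U)) =
      (if d < p then 0 else card {a \<in> S. fst a + snd a = d - p})"
    proof -
      have eq: "?F (S - U) = f ` {a \<in> S. fst a + snd a + p = d}"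
        using deg by (auto simp flip: img)
      have "card (?F (S - U)) = card {a \<in> S. fst a + snd a + p = d}"
        unfolding eq by (rule card_image) (use inj in \<open>simp add: inj_def inj_on_def\<close>)
      moreover have "{a \<in> S. fst a + snd a + p = d} =
        (if d < p then {} else {a \<in> S. fst a + snd a = d - p})" by auto
      ultimately show ?thesis by simp
    qed
    ultimately show ?thesis
      by (simp add: degree_series_def fps_X_power_mult_nth)
  qed
  then have "degree_series S = degree_series U + fps_X ^ p * degree_series S"
    by (simp add: fps_eq_iff)
  then show ?thesis by (simp add: algebra_simps)
qed

text \<open>One translation for each coordinate direction: cutting down to \<open>x < p\<close> and
  then to \<open>y < p\<close> costs a factor \<open>1 - fps_X ^ p\<close> each time.\<close>

lemma degree_series_periodic:
  assumes "\<And>x y. (x + p, y) \<in> S \<longleftrightarrow> (x, y) \<in> S" "\<And>x y. (x, y + p) \<in> S \<longleftrightarrow> (x, y) \<in> S"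
  shows "degree_series {(x, y) \<in> S. x < p \<and> y < p} = degree_series S * (1 - fps_X ^ p) ^ 2"
proof -
  let ?U = "{(x, y) \<in> S. x < p}" and ?V = "{(x, y) \<in> S. x < p \<and> y < p}"
  have "degree_series ?U = degree_series S * (1 - fps_X ^ p)"
  proof (rule degree_series_translate[where f = "\<lambda>a. (fst a + p, snd a)"])
    have "(x, y) \<in> (\<lambda>a. (fst a + p, snd a)) ` S" if "(x, y) \<in> S" "\<not> x < p" for x y
      by (rule image_eqI[of _ _ "(x - p, y)"]) (use that assms(1)[of "x - p" y] in auto)
    then show "(\<lambda>a. (fst a + p, snd a)) ` S = S - ?U"
      using assms(1) by auto
  qed (auto simp: inj_def)
  moreover have "degree_series ?V = degree_series ?U * (1 - fps_X ^ p)"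
  proof (rule degree_series_translate[where f = "\<lambda>a. (fst a, snd a + p)"])
    have "(x, y) \<in> (\<lambda>a. (fst a, snd a + p)) ` ?U" if "(x, y) \<in> S" "x < p" "\<not> y < p" for x y
      by (rule image_eqI[of _ _ "(x, y - p)"]) (use that assms(2)[of x "y - p"] in auto)
    then show "(\<lambda>a. (fst a, snd a + p)) ` ?U = ?U - ?V"
      using assms(2) by auto
  qed (auto simp: inj_def)
  ultimately show ?thesis by (simp add: power2_eq_square mult.assoc)
qed

text \<open>Distinct degrees make every coefficient 0 or 1, so the sum over points can be reindexed
  by degrees.\<close>

lemma degree_series_inj_on:
  assumes "finite S" "inj_on (\<lambda>a. fst a + snd a) S"
  shows "degree_series S = (\<Sum>d\<in>(\<lambda>a. fst a + snd a) ` S. fps_X ^ d)"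
proof -
  have "of_nat (card {a \<in> S. fst a + snd a = d}) =
      (\<Sum>a\<in>S. fps_nth (fps_X ^ (fst a + snd a)) d :: rat)" for d
    using assms(1) by (simp add: eq_commute[of d] sum.If_cases Int_def)
  then have "degree_series S = (\<Sum>a\<in>S. fps_X ^ (fst a + snd a))"
    by (simp add: fps_eq_iff degree_series_def fps_sum_nth)
  then show ?thesis by (simp add: sum.reindex[OF assms(2)])
qed

section \<open>Linear substitutions in polynomials\<close>

lemma poly_mapping_sum_single: "(\<Sum>m\<in>Poly_Mapping.keys f. Poly_Mapping.single m (Poly_Mapping.lookup f m)) = f"
proof (rule poly_mapping_eqI)
  fix m
  show "Poly_Mapping.lookup (\<Sum>m\<in>Poly_Mapping.keys f. Poly_Mapping.single m (Poly_Mapping.lookup f m)) m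
    = Poly_Mapping.lookup f m"
    by (simp add: lookup_sum lookup_single when_def in_keys_iff)
qed

text \<open>A polynomial is the sum of its terms, so a property closed under addition need only be
  checked on single terms.\<close>

lemma poly_mapping_induct_add [case_names single add]:
  fixes f :: "'a \<Rightarrow>\<^sub>0 'b::comm_monoid_add"
  assumes single: "\<And>m c. P (Poly_Mapping.single m c)" and add: "\<And>f g. P f \<Longrightarrow> P g \<Longrightarrow> P (f + g)"
  shows "P f"
proof -
  have "P (\<Sum>m\<in>M. Poly_Mapping.single m (Poly_Mapping.lookup f m))" if "finite M" for M
    using that
  proof induction
    case empty
    then show ?case using single[of undefined 0] by simp
  next
    case (insert m M)
    then show ?case using single add by simp
  qed
  from this[of "Poly_Mapping.keys f"] show ?thesis by (simp add: poly_mapping_sum_single)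
qed

lemma const_add: "const (a + b) = const a + const b"
  by (simp add: const_def single_add)

lemma const_mult: "const (a * b) = const a * const b"
  by (simp add: const_def mult_single)

lemma const_0 [simp]: "const 0 = 0"
  by (simp add: const_def)

lemma const_1 [simp]: "const 1 = 1"
  by (simp add: const_def)

lemma const_sum: "const (sum f S) = (\<Sum>i\<in>S. const (f i))"
  by (induction S rule: infinite_finite_induct) (simp_all add: const_add)

lemma lookup_const_mult: "Poly_Mapping.lookup (const c * f) m = c * Poly_Mapping.lookup f m"
proof (induction f rule: poly_mapping_induct_add)
  case (single m' d)
  then show ?case by (simp add: const_def mult_single lookup_single when_def)
next
  case (add f g)
  then show ?case by (simp add: algebra_simps lookup_add)
qed

definition subst_monom :: "'k::field ^ 'n ^ 'n \<Rightarrow> ('n::finite \<Rightarrow>\<^sub>0 nat) \<Rightarrow> ('n, 'k) coord_ring" where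
  "subst_monom A m =
     (\<Prod>i\<in>UNIV. (\<Sum>j\<in>UNIV. const (A $ i $ j) * coord j) ^ Poly_Mapping.lookup m i)"

text \<open>Terms may cancel in \<open>f + g\<close>. Summing over a common finite set that contains
  all the supports makes additivity immediate.\<close>

lemma subst_linear_superset:
  assumes "finite S" "Poly_Mapping.keys f \<subseteq> S"
  shows "subst_linear A f = (\<Sum>m\<in>S. const (Poly_Mapping.lookup f m) * subst_monom A m)"
  unfolding subst_linear_def subst_monom_def
  by (rule sum.mono_neutral_left) (use assms in \<open>auto simp: in_keys_iff\<close>)

lemma subst_linear_add: "subst_linear A (f + g) = subst_linear A f + subst_linear A g"
proof -
  let ?S = "Poly_Mapping.keys f \<union> Poly_Mapping.keys g"
  have "Poly_Mapping.keys (f + g) \<subseteq> ?S" by (rule keys_add)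
  then show ?thesis
    by (simp add: subst_linear_superset[of ?S] lookup_add const_add algebra_simps sum.distrib)
qed

lemma subst_linear_single: "subst_linear A (Poly_Mapping.single m c) = const c * subst_monom A m"
  by (simp add: subst_linear_superset[of "{m}"])

lemma subst_linear_0 [simp]: "subst_linear A 0 = 0"
  by (simp add: subst_linear_def)

lemma subst_linear_sum: "subst_linear A (sum f S) = (\<Sum>i\<in>S. subst_linear A (f i))"
  by (induction S rule: infinite_finite_induct) (simp_all add: subst_linear_add)

lemma subst_monom_0 [simp]: "subst_monom A 0 = 1"
  by (simp add: subst_monom_def)

lemma subst_monom_add: "subst_monom A (m + m') = subst_monom A m * subst_monom A m'"
  by (simp add: subst_monom_def lookup_add power_add prod.distrib)

lemma subst_linear_mult: "subst_linear A (f * g) = subst_linear A f * subst_linear A g"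
proof (induction f rule: poly_mapping_induct_add)
  case (single m c)
  show ?case
  proof (induction g rule: poly_mapping_induct_add)
    case (single m' c')
    then show ?case
      by (simp add: mult_single subst_linear_single subst_monom_add const_mult algebra_simps)
  next
    case (add f g)
    then show ?case by (simp add: algebra_simps subst_linear_add)
  qed
next
  case (add f g)
  then show ?case by (simp add: algebra_simps subst_linear_add)
qed

lemma subst_linear_const [simp]: "subst_linear A (const c) = const c"
  unfolding const_def by (subst subst_linear_single) (simp add: const_def)

lemma subst_linear_1 [simp]: "subst_linear A 1 = 1"
  using subst_linear_const[of A 1] by simp

lemma subst_linear_power: "subst_linear A (f ^ n) = subst_linear A f ^ n"
  by (induction n) (simp_all add: subst_linear_mult)

lemma subst_linear_prod: "subst_linear A (prod f S) = (\<Prod>i\<in>S. subst_linear A (f i))"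
  by (induction S rule: infinite_finite_induct) (simp_all add: subst_linear_mult)

lemma subst_monom_single:
  "subst_monom A (Poly_Mapping.single i 1) = (\<Sum>j\<in>UNIV. const (A $ i $ j) * coord j)"
proof -
  have "subst_monom A (Poly_Mapping.single i 1) =
    (\<Prod>k\<in>UNIV. if k = i then (\<Sum>j\<in>UNIV. const (A $ k $ j) * coord j) else 1)"
    unfolding subst_monom_def by (rule prod.cong) (auto simp: lookup_single when_def)
  then show ?thesis by simp
qed

lemma subst_linear_coord: "subst_linear A (coord i) = (\<Sum>j\<in>UNIV. const (A $ i $ j) * coord j)"
  unfolding coord_def by (subst subst_linear_single) (simp only: subst_monom_single const_1 mult_1 coord_def)

text \<open>Substitution is pullback of functions and so reverses products: \<open>B\<close>
  followed by \<open>A\<close> turns \<open>f\<close> into the function with value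
  \<open>f (B (A v))\<close> at \<open>v\<close>.\<close>

lemma subst_linear_compose: "subst_linear A (subst_linear B f) = subst_linear (B ** A) f"
proof (induction f rule: poly_mapping_induct_add)
  case (single m c)
  have "subst_linear A (\<Sum>j\<in>UNIV. const (B $ i $ j) * coord j) =
    (\<Sum>j\<in>UNIV. const ((B ** A) $ i $ j) * coord j)" for i
    unfolding subst_linear_sum subst_linear_mult subst_linear_const subst_linear_coord
      matrix_matrix_mult_def sum_distrib_left
    by (subst sum.swap) (simp add: const_sum const_mult sum_distrib_right mult.assoc)
  then have "subst_linear A (subst_monom B m) = subst_monom (B ** A) m"
    by (simp add: subst_monom_def subst_linear_prod subst_linear_power)
  then show ?case by (simp add: subst_linear_single subst_linear_mult)
next
  case (add f g)
  then show ?case by (simp add: subst_linear_add)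
qed

lemma single_eq_const_prod_coord:
  "Poly_Mapping.single m c = const c * (\<Prod>i\<in>UNIV. coord (i::'n::finite) ^ Poly_Mapping.lookup m i)"
proof -
  have pow: "coord i ^ k = Poly_Mapping.single (Poly_Mapping.single i k) (1::'a)" for i :: 'n and k
    by (induction k) (simp_all add: coord_def mult_single flip: single_add)
  have "(\<Prod>i\<in>S. Poly_Mapping.single (g i) (1::'a)) = Poly_Mapping.single (sum g S) 1"
    for S :: "'n set" and g :: "'n \<Rightarrow> 'n \<Rightarrow>\<^sub>0 nat"
    by (induction S rule: infinite_finite_induct) (simp_all add: mult_single)
  moreover have "(\<Sum>i\<in>UNIV. Poly_Mapping.single i (Poly_Mapping.lookup m i)) = m"
    by (rule poly_mapping_eqI) (simp add: lookup_sum lookup_single when_def)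
  ultimately show ?thesis by (simp add: pow const_def mult_single)
qed

text \<open>A diagonal substitution rescales each variable, so monomials are eigenvectors and each
  coefficient is multiplied by the eigenvalue of its monomial.\<close>

lemma subst_linear_diagonal:
  fixes A :: "'k::field ^ 'n ^ 'n"
  assumes "\<And>i j. i \<noteq> j \<Longrightarrow> A $ i $ j = 0"
  shows "Poly_Mapping.lookup (subst_linear A f) m =
    (\<Prod>i\<in>UNIV. A $ i $ i ^ Poly_Mapping.lookup m i) * Poly_Mapping.lookup f m"
proof (induction f rule: poly_mapping_induct_add)
  case (single m' c)
  have "(\<Sum>j\<in>UNIV. const (A $ i $ j) * coord j) = const (A $ i $ i) * coord i" for i
  proof -
    have "(\<Sum>j\<in>UNIV. const (A $ i $ j) * coord j) =
        (\<Sum>j\<in>UNIV. if j = i then const (A $ i $ i) * coord i else 0)"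
      using assms by (intro sum.cong) auto
    then show ?thesis by simp
  qed
  then have "subst_monom A m' = (\<Prod>i\<in>UNIV. const (A $ i $ i) ^ Poly_Mapping.lookup m' i) *
      (\<Prod>i\<in>UNIV. coord i ^ Poly_Mapping.lookup m' i)"
    by (simp add: subst_monom_def power_mult_distrib prod.distrib)
  also have "(\<Prod>i\<in>UNIV. const (A $ i $ i) ^ Poly_Mapping.lookup m' i) =
      (const (\<Prod>i\<in>UNIV. A $ i $ i ^ Poly_Mapping.lookup m' i) :: ('n, 'k) coord_ring)"
  proof -
    have "const a ^ k = (const (a ^ k) :: ('n, 'k) coord_ring)" for a k
      by (induction k) (simp_all add: const_mult)
    moreover have "(\<Prod>i\<in>S. const (g i)) = (const (prod g S) :: ('n, 'k) coord_ring)" for S :: "'n set" and g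
      by (induction S rule: infinite_finite_induct) (simp_all add: const_mult)
    ultimately show ?thesis by simp
  qed
  finally have "subst_linear A (Poly_Mapping.single m' c) =
      const (\<Prod>i\<in>UNIV. A $ i $ i ^ Poly_Mapping.lookup m' i) *
      (const c * (\<Prod>i\<in>UNIV. coord i ^ Poly_Mapping.lookup m' i))"
    by (simp only: subst_linear_single mult_ac)
  also have "const c * (\<Prod>i\<in>UNIV. coord i ^ Poly_Mapping.lookup m' i) = Poly_Mapping.single m' c"
    by (rule single_eq_const_prod_coord[symmetric])
  finally have "subst_linear A (Poly_Mapping.single m' c) =
      const (\<Prod>i\<in>UNIV. A $ i $ i ^ Poly_Mapping.lookup m' i) * Poly_Mapping.single m' c" .
  then show ?case by (simp add: lookup_const_mult lookup_single when_def)
next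
  case (add f g)
  then show ?case by (simp add: subst_linear_add lookup_add algebra_simps)
qed

section \<open>Homogeneous polynomials under linear substitution\<close>

lemma homogeneous_iff_lookup:
  "f \<in> homogeneous d \<longleftrightarrow>
    (\<forall>m. (\<Sum>i\<in>UNIV. Poly_Mapping.lookup m i) \<noteq> d \<longrightarrow> Poly_Mapping.lookup f m = 0)"
  by (auto simp: homogeneous_def in_keys_iff)

lemma homogeneous_0 [simp]: "0 \<in> homogeneous d"
  by (simp add: homogeneous_def)

lemma homogeneous_add: "f \<in> homogeneous d \<Longrightarrow> g \<in> homogeneous d \<Longrightarrow> f + g \<in> homogeneous d"
  by (simp add: homogeneous_iff_lookup lookup_add)

lemma homogeneous_sum: "(\<And>i. i \<in> S \<Longrightarrow> f i \<in> homogeneous d) \<Longrightarrow> sum f S \<in> homogeneous d"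
  by (induction S rule: infinite_finite_induct) (simp_all add: homogeneous_add)

lemma homogeneous_mult:
  assumes "f \<in> homogeneous d" "g \<in> homogeneous e" shows "f * g \<in> homogeneous (d + e)"
  unfolding homogeneous_def
proof safe
  fix m assume "m \<in> Poly_Mapping.keys (f * g)"
  then obtain a b where "m = a + b" "a \<in> Poly_Mapping.keys f" "b \<in> Poly_Mapping.keys g"
    using keys_mult[of f g] by blast
  then show "(\<Sum>i\<in>UNIV. Poly_Mapping.lookup m i) = d + e"
    using assms by (simp add: homogeneous_def lookup_add sum.distrib)
qed

lemma homogeneous_const: "const c \<in> homogeneous 0"
  by (auto simp: homogeneous_def const_def)

lemma homogeneous_coord: "coord i \<in> homogeneous 1"
  by (auto simp: homogeneous_def coord_def lookup_single when_def)

lemma homogeneous_const_mult: "f \<in> homogeneous d \<Longrightarrow> const c * f \<in> homogeneous d"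
  using homogeneous_mult[OF homogeneous_const] by fastforce

lemma homogeneous_power: "f \<in> homogeneous d \<Longrightarrow> f ^ k \<in> homogeneous (k * d)"
  by (induction k) (use homogeneous_mult homogeneous_const[of 1] in auto)

lemma homogeneous_prod:
  "(\<And>i. i \<in> S \<Longrightarrow> f i \<in> homogeneous (d i)) \<Longrightarrow> prod f S \<in> homogeneous (sum d S)"
  by (induction S rule: infinite_finite_induct)
    (use homogeneous_const[of 1] in \<open>simp_all add: homogeneous_mult\<close>)

text \<open>Each variable is replaced by a linear form, so a monomial becomes a product of as many
  linear forms as its degree.\<close>

lemma homogeneous_subst_linear:
  assumes "f \<in> homogeneous d" shows "subst_linear A f \<in> homogeneous d"
proof -
  have "subst_monom A m \<in> homogeneous (\<Sum>i\<in>UNIV. Poly_Mapping.lookup m i * 1)" for m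
    unfolding subst_monom_def
    by (intro homogeneous_prod homogeneous_power homogeneous_sum homogeneous_const_mult
        homogeneous_coord)
  then have "const (Poly_Mapping.lookup f m) * subst_monom A m \<in> homogeneous d"
    if "m \<in> Poly_Mapping.keys f" for m
    using that assms homogeneous_const_mult[of "subst_monom A m"]
    by (fastforce simp: homogeneous_def)
  then show ?thesis
    unfolding subst_linear_superset[OF finite_keys order.refl] by (rule homogeneous_sum)
qed

section \<open>Extension of scalars\<close>

lemma lookup_map_poly:
  "\<phi> 0 = 0 \<Longrightarrow> Poly_Mapping.lookup (Poly_Mapping.map \<phi> f) m = \<phi> (Poly_Mapping.lookup f m)"
  by (simp add: Poly_Mapping.map.rep_eq when_def)

lemma map_poly_add:
  fixes \<phi> :: "'a::ab_group_add \<Rightarrow> 'b::ab_group_add"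
  assumes "\<And>x y. \<phi> (x + y) = \<phi> x + \<phi> y"
  shows "Poly_Mapping.map \<phi> (f + g) = Poly_Mapping.map \<phi> f + Poly_Mapping.map \<phi> g"
proof -
  have "\<phi> 0 = 0" using assms[of 0 0] by simp
  then show ?thesis by (intro poly_mapping_eqI) (simp add: lookup_map_poly lookup_add assms)
qed

lemma map_poly_sum:
  fixes \<phi> :: "'a::ab_group_add \<Rightarrow> 'b::ab_group_add"
  assumes "\<And>x y. \<phi> (x + y) = \<phi> x + \<phi> y"
  shows "Poly_Mapping.map \<phi> (sum f S) = (\<Sum>i\<in>S. Poly_Mapping.map \<phi> (f i))"
proof -
  have "Poly_Mapping.map \<phi> 0 = (0 :: 'c \<Rightarrow>\<^sub>0 'b)" by (simp add: map_eq_zero_iff)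
  then show ?thesis
    by (induction S rule: infinite_finite_induct) (simp_all add: map_poly_add[OF assms])
qed

locale field_extension =
  fixes \<iota> :: "'k::field \<Rightarrow> 'K::field"
  assumes embedding: "field_embedding \<iota>"
begin

lemma emb_1 [simp]: "\<iota> 1 = 1"
  and emb_add: "\<iota> (x + y) = \<iota> x + \<iota> y"
  and emb_mult: "\<iota> (x * y) = \<iota> x * \<iota> y"
  using embedding by (auto simp: field_embedding_def)

lemma emb_0 [simp]: "\<iota> 0 = 0"
  using emb_add[of 0 0] by (metis add_0 add_cancel_right_right)

lemma emb_sum: "\<iota> (sum f S) = (\<Sum>i\<in>S. \<iota> (f i))"
  by (induction S rule: infinite_finite_induct) (simp_all add: emb_add)

lemma emb_eq_0_iff [simp]: "\<iota> x = 0 \<longleftrightarrow> x = 0"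
  using emb_mult[of x "inverse x"] by (cases "x = 0") auto

lemma map_matrix_emb_mult: "map_matrix \<iota> (A ** B) = map_matrix \<iota> A ** map_matrix \<iota> B"
  by (simp add: vec_eq_iff matrix_matrix_mult_def emb_sum emb_mult)

lemma map_matrix_emb_mat_1: "map_matrix \<iota> (mat 1) = mat 1"
  by (simp add: vec_eq_iff mat_def)

abbreviation base_change :: "('n, 'k) coord_ring \<Rightarrow> ('n, 'K) coord_ring" where
  "base_change \<equiv> Poly_Mapping.map \<iota>"

lemma inj_base_change: "inj base_change"
proof
  fix f g :: "('n, 'k) coord_ring"
  assume eq: "base_change f = base_change g"
  have "\<iota> (Poly_Mapping.lookup f m - Poly_Mapping.lookup g m) = 0" for m
    using emb_add[of "Poly_Mapping.lookup f m - Poly_Mapping.lookup g m" "Poly_Mapping.lookup g m"]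
      arg_cong[OF eq, of "\<lambda>h. Poly_Mapping.lookup h m"] by (simp add: lookup_map_poly)
  then show "f = g" by (intro poly_mapping_eqI) simp
qed

lemma base_change_add: "base_change (f + g) = base_change f + base_change g"
  by (rule map_poly_add) (rule emb_add)

lemma base_change_sum: "base_change (sum f S) = (\<Sum>i\<in>S. base_change (f i))"
  by (rule map_poly_sum) (rule emb_add)

lemma base_change_mult: "base_change (f * g) = base_change f * base_change g"
proof (induction f rule: poly_mapping_induct_add)
  case (single m c)
  show ?case
  proof (induction g rule: poly_mapping_induct_add)
    case (single m' c')
    then show ?case by (simp add: mult_single emb_mult)
  next
    case (add f g)
    then show ?case by (simp add: algebra_simps base_change_add)
  qed
next
  case (add f g)
  then show ?case by (simp add: algebra_simps base_change_add)
qed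

lemma base_change_const: "base_change (const c) = const (\<iota> c)"
  by (simp add: const_def)

lemma base_change_coord: "base_change (coord i) = coord i"
  by (simp add: coord_def)

lemma base_change_subst_monom:
  fixes A :: "'k ^ 'n ^ 'n"
  shows "base_change (subst_monom A m) = subst_monom (map_matrix \<iota> A) m"
proof -
  have 1: "base_change 1 = (1 :: ('n, 'K) coord_ring)" using base_change_const[of 1] by simp
  have "base_change (f ^ k) = base_change f ^ k" for f :: "('n, 'k) coord_ring" and k
    by (induction k) (simp_all add: base_change_mult 1)
  moreover have "base_change (prod f S) = (\<Prod>i\<in>S. base_change (f i))"
    for f :: "'n \<Rightarrow> ('n, 'k) coord_ring" and S
    by (induction S rule: infinite_finite_induct) (simp_all add: base_change_mult 1)
  ultimately show ?thesis
    by (simp add: subst_monom_def base_change_sum base_change_mult base_change_const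
        base_change_coord)
qed

lemma base_change_subst_linear:
  "base_change (subst_linear A f) = subst_linear (map_matrix \<iota> A) (base_change f)"
proof (induction f rule: poly_mapping_induct_add)
  case (single m c)
  then show ?case
    by (simp add: subst_linear_single base_change_mult base_change_const base_change_subst_monom)
next
  case (add f g)
  then show ?case by (simp add: base_change_add subst_linear_add)
qed

text \<open>Through \<open>\<iota>\<close> the field \<open>'K\<close> is a vector space over
  \<open>'k\<close>, and \<open>\<phi> e\<close> is the coordinate at \<open>e\<close> in a basis.
  The index \<open>e\<close> can run over all of \<open>'K\<close> because
  \<open>representation\<close> is zero outside the basis.\<close>

lemma ex_coordinates:
  obtains \<phi> :: "'K \<Rightarrow> 'K \<Rightarrow> 'k" where
    "\<And>e x y. \<phi> e (x + y) = \<phi> e x + \<phi> e y" "\<And>e a x. \<phi> e (\<iota> a * x) = a * \<phi> e x"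
    "\<And>x. finite {e. \<phi> e x \<noteq> 0}" "\<And>x. (\<Sum>e | \<phi> e x \<noteq> 0. \<iota> (\<phi> e x) * e) = x"
proof -
  interpret vector_space "\<lambda>a x. \<iota> a * x"
    by unfold_locales (simp_all add: algebra_simps emb_add emb_mult)
  define E where "E = extend_basis {}"
  have ind: "independent E" and sp: "\<And>x. x \<in> span E"
    unfolding E_def
    by (simp_all add: independent_extend_basis span_extend_basis independent_empty)
  show thesis
    by (rule that[of "\<lambda>e x. representation E x e"])
      (simp_all add: representation_add[OF ind sp sp] representation_scale[OF ind sp]
        finite_representation sum_nonzero_representation_eq[OF ind sp])
qed

context
  fixes \<phi> :: "'K \<Rightarrow> 'k"
  assumes add: "\<phi> (x + y) = \<phi> x + \<phi> y" and lin: "\<phi> (\<iota> a * x) = a * \<phi> x"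
begin

lemma functional_0: "\<phi> 0 = 0"
  using add[of 0 0] by (metis add_0 add_cancel_right_right)

lemma map_functional_mult_base_change:
  "Poly_Mapping.map \<phi> (const c * base_change f) = const (\<phi> c) * f"
proof -
  have "\<phi> (c * \<iota> x) = \<phi> c * x" for c x using lin[of x c] by (simp add: mult.commute)
  then show ?thesis
    by (intro poly_mapping_eqI) (simp add: lookup_map_poly functional_0 lookup_const_mult)
qed

text \<open>A matrix over \<open>'k\<close> turns monomials into polynomials over \<open>'k\<close>,
  so the functional acts only on the coefficients of \<open>f\<close>. Consequently it maps
  invariants over \<open>'K\<close> to invariants over \<open>'k\<close>.\<close>

lemma map_functional_subst_linear:
  "Poly_Mapping.map \<phi> (subst_linear (map_matrix \<iota> A) f) = subst_linear A (Poly_Mapping.map \<phi> f)"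
proof (induction f rule: poly_mapping_induct_add)
  case (single m c)
  then show ?case
    by (simp add: subst_linear_single map_functional_mult_base_change functional_0
        flip: base_change_subst_monom)
next
  case (add f g)
  then show ?case by (simp add: map_poly_add[OF \<open>\<And>x y. \<phi> (x + y) = \<phi> x + \<phi> y\<close>] subst_linear_add)
qed

end

text \<open>A basis of the invariants over \<open>'k\<close> remains a basis over \<open>'K\<close>;
  the coordinate functionals give both spanning and independence.\<close>

lemma dim_base_change_invariants:
  fixes \<A> :: "('k ^ 'n ^ 'n) set"
  shows "vector_space.dim scale_poly {f \<in> homogeneous d. \<forall>A\<in>\<A>. subst_linear A f = f} =
    vector_space.dim scale_poly
      {f \<in> homogeneous d. \<forall>A\<in>\<A>. subst_linear (map_matrix \<iota> A) f = f}"
    (is "vector_space.dim _ ?V = vector_space.dim _ ?W")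
proof -
  interpret k: vector_space "scale_poly :: 'k \<Rightarrow> ('n, 'k) coord_ring \<Rightarrow> _"
    by (rule vector_space_scale_poly)
  interpret K: vector_space "scale_poly :: 'K \<Rightarrow> ('n, 'K) coord_ring \<Rightarrow> _"
    by (rule vector_space_scale_poly)
  obtain \<phi> :: "'K \<Rightarrow> 'K \<Rightarrow> 'k" where
    add: "\<And>e x y. \<phi> e (x + y) = \<phi> e x + \<phi> e y" and lin: "\<And>e a x. \<phi> e (\<iota> a * x) = a * \<phi> e x"
    and fin: "\<And>x. finite {e. \<phi> e x \<noteq> 0}" and expand: "\<And>x. (\<Sum>e | \<phi> e x \<noteq> 0. \<iota> (\<phi> e x) * e) = x"
    by (rule ex_coordinates) (rule that)
  have [simp]: "\<phi> e 0 = 0" for e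
    by (rule functional_0[of "\<phi> e", OF add lin])
  obtain B where B: "B \<subseteq> ?V" "k.independent B" "?V \<subseteq> k.span B" "card B = k.dim ?V"
    by (rule k.basis_exists)
  let ?B = "base_change ` B"
  have inj: "inj_on base_change S" for S :: "('n, 'k) coord_ring set"
    using inj_base_change by (rule inj_on_subset) simp
  have "?B \<subseteq> ?W"
    using B(1) by (auto simp: homogeneous_iff_lookup lookup_map_poly simp flip: base_change_subst_linear)
  moreover have "?W \<subseteq> K.span ?B"
  proof
    fix f assume f: "f \<in> ?W"
    have span: "base_change h \<in> K.span ?B" if "h \<in> k.span B" for h
      using that
    proof (induction rule: k.span_induct_alt)
      case base
      have "base_change 0 = (0 :: ('n, 'K) coord_ring)" by (simp add: map_eq_zero_iff)
      then show ?case by (simp add: K.span_zero)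
    next
      case (step c x y)
      have "base_change (scale_poly c x + y) = scale_poly (\<iota> c) (base_change x) + base_change y"
        by (simp add: scale_poly_def base_change_add base_change_mult base_change_const)
      then show ?case using step by (auto intro: K.span_add K.span_scale K.span_base)
    qed
    \<comment> \<open>Each coordinate of \<open>f\<close> is an invariant over \<open>'k\<close> and
      hence lies in the span of \<open>B\<close>.\<close>
    have "Poly_Mapping.map (\<phi> e) f \<in> ?V" for e
      using f by (auto simp: homogeneous_iff_lookup lookup_map_poly
          simp flip: map_functional_subst_linear[of "\<phi> e", OF add lin])
    then have in_span: "scale_poly e (base_change (Poly_Mapping.map (\<phi> e) f)) \<in> K.span ?B" for e
      using B(3) by (intro K.span_scale span) blast
    \<comment> \<open>The elements at which some coefficient of \<open>f\<close> has a nonzero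
      coordinate. They are finitely many, so \<open>f\<close> is a finite combination of its
      coordinates.\<close>
    define S where "S = (\<Union>m\<in>Poly_Mapping.keys f. {e. \<phi> e (Poly_Mapping.lookup f m) \<noteq> 0})"
    have "finite S" unfolding S_def using fin by simp
    have "f = (\<Sum>e\<in>S. scale_poly e (base_change (Poly_Mapping.map (\<phi> e) f)))"
    proof (rule poly_mapping_eqI)
      fix m
      let ?c = "Poly_Mapping.lookup f m"
      have "{e. \<phi> e ?c \<noteq> 0} \<subseteq> S"
        by (cases "m \<in> Poly_Mapping.keys f") (auto simp: S_def in_keys_iff)
      then have "?c = (\<Sum>e\<in>S. \<iota> (\<phi> e ?c) * e)"
        using \<open>finite S\<close> by (subst expand[of ?c, symmetric], intro sum.mono_neutral_left) auto
      then show "?c = Poly_Mapping.lookup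
          (\<Sum>e\<in>S. scale_poly e (base_change (Poly_Mapping.map (\<phi> e) f))) m"
        by (simp add: lookup_sum scale_poly_def lookup_const_mult lookup_map_poly mult.commute)
    qed
    moreover have "(\<Sum>e\<in>S. scale_poly e (base_change (Poly_Mapping.map (\<phi> e) f))) \<in> K.span ?B"
      by (rule K.span_sum) (rule in_span)
    ultimately show "f \<in> K.span ?B" by (rule ssubst)
  qed
  moreover have "K.independent ?B"
    unfolding K.independent_explicit_module
  proof (intro allI impI)
    fix t u v
    assume t: "finite t" "t \<subseteq> ?B" and sum: "(\<Sum>v\<in>t. scale_poly (u v) v) = 0" and v: "v \<in> t"
    obtain s where s: "s \<subseteq> B" "t = base_change ` s" using t(2) by (auto simp: subset_image_iff)
    have fs: "finite s" using t(1) s(2) inj finite_image_iff by blast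
    obtain w where w: "w \<in> s" "v = base_change w" using v s(2) by blast
    \<comment> \<open>The functional turns a relation over \<open>'K\<close> into one over
      \<open>'k\<close> among elements of \<open>B\<close>. Thus every coordinate of
      \<open>u v\<close> vanishes, and with it \<open>u v\<close>.\<close>
    have "\<phi> e (u v) = 0" for e
    proof -
      have "(\<Sum>w\<in>s. const (u (base_change w)) * base_change w) = 0"
        using sum by (simp add: s(2) sum.reindex[OF inj] scale_poly_def)
      then have "Poly_Mapping.map (\<phi> e) (\<Sum>w\<in>s. const (u (base_change w)) * base_change w) = 0"
        by (simp add: map_eq_zero_iff)
      then have "(\<Sum>w\<in>s. scale_poly (\<phi> e (u (base_change w))) w) = 0"
        by (simp add: map_poly_sum[of "\<phi> e", OF add] map_functional_mult_base_change[of "\<phi> e", OF add lin]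
            scale_poly_def)
      then have "\<phi> e (u (base_change w)) = 0"
        using k.independentD[OF B(2) fs s(1), of "\<lambda>w. \<phi> e (u (base_change w))"] w(1) by blast
      then show ?thesis by (simp add: w(2))
    qed
    then show "u v = 0" using expand[of "u v"] by simp
  qed
  moreover have "card ?B = k.dim ?V"
    using B(4) by (simp add: card_image[OF inj])
  ultimately have "K.dim ?W = k.dim ?V" by (rule K.dim_unique)
  then show ?thesis by (rule sym)
qed

end

section \<open>Diagonalizable invariants\<close>

text \<open>The monomials with exponent in \<open>M\<close> form a basis; reading off one
  coefficient of a relation shows independence.\<close>

lemma dim_polys_supported_on:
  fixes M :: "('n::finite \<Rightarrow>\<^sub>0 nat) set"
  shows "vector_space.dim scale_poly
    {f :: ('n, 'k::field) coord_ring. \<forall>m. m \<notin> M \<longrightarrow> Poly_Mapping.lookup f m = 0} = card M"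
    (is "vector_space.dim _ ?V = _")
proof -
  interpret vector_space "scale_poly :: 'k \<Rightarrow> ('n, 'k) coord_ring \<Rightarrow> _"
    by (rule vector_space_scale_poly)
  let ?s = "\<lambda>m :: 'n \<Rightarrow>\<^sub>0 nat. Poly_Mapping.single m (1::'k)"
  have inj: "inj_on ?s S" for S
    by (auto simp: inj_on_def dest: arg_cong[of _ _ Poly_Mapping.keys])
  have scale: "scale_poly c (?s m) = Poly_Mapping.single m c" for c m
    by (simp add: scale_poly_def const_def mult_single)
  show ?thesis
  proof (rule dim_unique[of "?s ` M"])
    show "?s ` M \<subseteq> ?V" by (auto simp: lookup_single when_def)
    show "?V \<subseteq> span (?s ` M)"
    proof
      fix f assume "f \<in> ?V"
      then have "Poly_Mapping.keys f \<subseteq> M" by (auto simp: in_keys_iff)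
      then have "(\<Sum>m\<in>Poly_Mapping.keys f. scale_poly (Poly_Mapping.lookup f m) (?s m)) \<in> span (?s ` M)"
        by (intro span_sum span_scale span_base) auto
      then show "f \<in> span (?s ` M)" by (simp add: scale poly_mapping_sum_single)
    qed
    show "independent (?s ` M)"
      unfolding independent_explicit_module
    proof (intro allI impI)
      fix t u v
      assume t: "finite t" "t \<subseteq> ?s ` M" and sum: "(\<Sum>v\<in>t. scale_poly (u v) v) = 0" and v: "v \<in> t"
      obtain S where S: "t = ?s ` S" using t(2) by (auto simp: subset_image_iff)
      have "finite S" using t(1) S inj finite_image_iff by blast
      obtain m where m: "m \<in> S" "v = ?s m" using v S by blast
      have "(\<Sum>m\<in>S. Poly_Mapping.single m (u (?s m))) = 0"
        using sum by (simp add: S sum.reindex[OF inj] scale)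
      then have "(\<Sum>m'\<in>S. Poly_Mapping.lookup (Poly_Mapping.single m' (u (?s m'))) m) = 0"
        by (metis lookup_sum lookup_zero)
      then show "u v = 0" using \<open>finite S\<close> m by (simp add: lookup_single when_def)
    qed
    show "card (?s ` M) = card M" by (rule card_image[OF inj])
  qed
qed

text \<open>The rows of \<open>Q\<close> serve as new coordinate functions:
  \<open>subst_linear Q\<close> maps the invariants of the diagonal matrices isomorphically onto
  those of the \<open>M g\<close>, and the former are spanned by invariant monomials.\<close>

lemma dim_invariants_diagonalizable:
  fixes M D :: "'g \<Rightarrow> 'k::field ^ 'n ^ 'n"
  assumes Q: "Q ** Q' = mat 1" "Q' ** Q = mat 1"
    and diag: "\<And>g. g \<in> G \<Longrightarrow> Q ** M g = D g ** Q"
    and D: "\<And>g i j. g \<in> G \<Longrightarrow> i \<noteq> j \<Longrightarrow> D g $ i $ j = 0"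
  shows "vector_space.dim scale_poly {f \<in> homogeneous d. \<forall>g\<in>G. subst_linear (M g) f = f} =
    card {m. (\<Sum>i\<in>UNIV. Poly_Mapping.lookup m i) = d \<and>
      (\<forall>g\<in>G. (\<Prod>i\<in>UNIV. D g $ i $ i ^ Poly_Mapping.lookup m i) = 1)}"
    (is "vector_space.dim _ ?V = card ?M")
proof -
  interpret vector_space "scale_poly :: 'k \<Rightarrow> ('n, 'k) coord_ring \<Rightarrow> _"
    by (rule vector_space_scale_poly)
  interpret Q: Vector_Spaces.linear "scale_poly :: 'k \<Rightarrow> ('n, 'k) coord_ring \<Rightarrow> _"
    scale_poly "subst_linear Q"
    by unfold_locales (simp_all add: subst_linear_add scale_poly_def subst_linear_mult)
  let ?W = "{f. \<forall>m. m \<notin> ?M \<longrightarrow> Poly_Mapping.lookup f m = 0}"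
  have subst_1: "subst_linear (mat 1) f = f" for f :: "('n, 'k) coord_ring"
    by (rule poly_mapping_eqI) (subst subst_linear_diagonal, simp_all add: mat_def)
  have QQ: "subst_linear Q (subst_linear Q' f) = f" "subst_linear Q' (subst_linear Q f) = f" for f
    by (simp_all add: subst_linear_compose Q subst_1)
  \<comment> \<open>Comparing coefficients, a polynomial is fixed exactly when it contains only
    monomials of eigenvalue 1.\<close>
  have W: "?W = {f \<in> homogeneous d. \<forall>g\<in>G. subst_linear (D g) f = f}"
  proof -
    have eq: "subst_linear (D g) f = f \<longleftrightarrow>
      (\<forall>m. (\<Prod>i\<in>UNIV. D g $ i $ i ^ Poly_Mapping.lookup m i) \<noteq> 1 \<longrightarrow> Poly_Mapping.lookup f m = 0)"
      if "g \<in> G" for g f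
      using subst_linear_diagonal[of "D g" f, OF D[OF that]]
      by (simp add: poly_mapping_eq_iff fun_eq_iff) blast
    show ?thesis
      by (intro Collect_cong) (simp add: homogeneous_iff_lookup eq, blast)
  qed
  \<comment> \<open>This is \<open>M g = Q' ** D g ** Q\<close>. As substitution reverses products,
    \<open>Q'\<close> is applied first.\<close>
  have subst_M: "subst_linear (M g) f = subst_linear Q (subst_linear (D g) (subst_linear Q' f))"
    if "g \<in> G" for g f
  proof -
    have "M g = Q' ** (D g ** Q)"
      by (simp only: diag[OF that, symmetric]) (simp add: matrix_mul_assoc Q)
    then show ?thesis by (simp add: subst_linear_compose matrix_mul_assoc)
  qed
  have "?V = subst_linear Q ` ?W"
  proof (intro equalityI subsetI)
    fix f assume "f \<in> ?V"
    then have f: "f \<in> homogeneous d" "\<And>g. g \<in> G \<Longrightarrow> subst_linear (M g) f = f" by simp_all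
    have "subst_linear (D g) (subst_linear Q' f) = subst_linear Q' f" if "g \<in> G" for g
      using arg_cong[OF f(2)[OF that], of "subst_linear Q'"] by (simp add: subst_M[OF that] QQ)
    then have "subst_linear Q' f \<in> ?W"
      unfolding W using homogeneous_subst_linear[OF f(1)] by blast
    then show "f \<in> subst_linear Q ` ?W" by (rule rev_image_eqI) (simp add: QQ)
  next
    fix h assume "h \<in> subst_linear Q ` ?W"
    then obtain f where "f \<in> ?W" and h: "h = subst_linear Q f" by (rule imageE)
    then have f: "f \<in> homogeneous d" "\<And>g. g \<in> G \<Longrightarrow> subst_linear (D g) f = f"
      unfolding W by simp_all
    show "h \<in> ?V"
      using homogeneous_subst_linear[OF f(1)] by (simp add: h subst_M QQ f(2))
  qed
  moreover have "dim (subst_linear Q ` ?W) = dim ?W"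
  proof -
    have inj: "inj_on (subst_linear Q) S" for S
      by (rule inj_on_inverseI[of _ "subst_linear Q'"]) (rule QQ)
    obtain B where B: "B \<subseteq> ?W" "independent B" "?W \<subseteq> span B" "card B = dim ?W"
      by (rule basis_exists)
    show ?thesis
    proof (rule dim_unique)
      show "subst_linear Q ` B \<subseteq> subst_linear Q ` ?W" using B(1) by (rule image_mono)
      show "subst_linear Q ` ?W \<subseteq> span (subst_linear Q ` B)"
        unfolding Q.span_image using B(3) by (rule image_mono)
      show "independent (subst_linear Q ` B)" by (rule Q.independent_injective_image[OF B(2) inj])
      show "card (subst_linear Q ` B) = dim ?W" using B(4) by (simp only: card_image[OF inj])
    qed
  qed
  ultimately show ?thesis by (simp only: dim_polys_supported_on)
qed

text \<open>An exponent vector in two variables is the pair of its entries; this passes from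
  monomials to the pairs counted by \<open>degree_series\<close>.\<close>

lemma card_exponents_2:
  assumes "UNIV = {i1, i2 :: 'n::finite}" "i1 \<noteq> i2"
  shows "card {m :: 'n \<Rightarrow>\<^sub>0 nat. P (Poly_Mapping.lookup m i1) (Poly_Mapping.lookup m i2)} =
    card {a. P (fst a) (snd a)}"
proof (rule bij_betw_same_card)
  have "m = Poly_Mapping.single i1 (Poly_Mapping.lookup m i1) +
      Poly_Mapping.single i2 (Poly_Mapping.lookup m i2)" for m :: "'n \<Rightarrow>\<^sub>0 nat"
  proof (rule poly_mapping_eqI)
    fix i :: 'n
    have "i = i1 \<or> i = i2" using assms(1) by blast
    then show "Poly_Mapping.lookup m i = Poly_Mapping.lookup
        (Poly_Mapping.single i1 (Poly_Mapping.lookup m i1) +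
          Poly_Mapping.single i2 (Poly_Mapping.lookup m i2)) i"
      using assms(2) by (auto simp: lookup_add lookup_single when_def)
  qed
  then show "bij_betw (\<lambda>m. (Poly_Mapping.lookup m i1, Poly_Mapping.lookup m i2))
      {m. P (Poly_Mapping.lookup m i1) (Poly_Mapping.lookup m i2)} {a. P (fst a) (snd a)}"
    using assms(2)
    by (intro bij_betwI[where g = "\<lambda>a. Poly_Mapping.single i1 (fst a) + Poly_Mapping.single i2 (snd a)"])
      (auto simp: lookup_add lookup_single when_def)
qed

section \<open>Characters of the cyclic group\<close>

text \<open>The order of \<open>u\<close> is exactly \<open>p\<close>: an exponent \<open>a\<close>
  prime to \<open>p\<close> has an inverse \<open>z\<close> modulo \<open>p\<close>, and
  \<open>u powi a = 1\<close> would give \<open>u = u powi (a * z) = 1\<close>.\<close>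

lemma power_int_eq_1_iff:
  fixes u :: "'a::field"
  assumes "prime p" "u ^ p = 1" "u \<noteq> 1"
  shows "u powi a = 1 \<longleftrightarrow> int p dvd a"
proof
  have u0: "u \<noteq> 0" using assms prime_gt_0_nat[of p] by (auto simp: zero_power)
  have up: "u powi (int p * k) = 1" for k
    by (simp add: power_int_mult assms(2))
  show "int p dvd a" if a: "u powi a = 1"
  proof (rule ccontr)
    assume "\<not> int p dvd a"
    then have "coprime a (int p)"
      using assms(1) prime_imp_coprime[of "int p" a] by (simp add: coprime_commute)
    then obtain z where "[a * z = 1] (mod int p)" using cong_solve_coprime_int by blast
    then obtain k where k: "a * z - 1 = int p * k" by (auto simp: cong_iff_dvd_diff)
    have "u = u powi (a * z - int p * k)" using k by (simp add: algebra_simps)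
    also have "\<dots> = 1" using u0 by (simp add: power_int_diff up power_int_mult a assms(2))
    finally show False using assms(3) by simp
  qed
  show "u powi a = 1" if "int p dvd a" using that up by (auto elim: dvdE)
qed

text \<open>The element \<open>u\<close> has \<open>p\<close> distinct powers, all of them
  \<open>p\<close>-th roots of unity, and the cardinality leaves room for no others.\<close>

lemma root_of_unity_eq_power:
  fixes u v :: "'a::field"
  assumes p: "prime p" and card: "card {z :: 'a. z ^ p = 1} = p"
    and u: "u ^ p = 1" "u \<noteq> 1" and v: "v ^ p = 1"
  shows "\<exists>n. v = u ^ n"
proof -
  have u0: "u \<noteq> 0" using u(1) p prime_gt_0_nat[of p] by (auto simp: zero_power)
  have inj: "inj_on (\<lambda>n. u ^ n) {..<p}"
  proof (rule inj_onI)
    fix i j assume ij: "i \<in> {..<p}" "j \<in> {..<p}" "u ^ i = u ^ j"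
    then have "u powi (int i - int j) = 1" using u0 by (simp add: power_int_diff)
    then have "int p dvd int i - int j" using power_int_eq_1_iff[OF p u] by blast
    then show "i = j" using dvd_abs_less_imp_zero[of "int p" "int i - int j"] ij(1,2) by auto
  qed
  have "(\<lambda>n. u ^ n) ` {..<p} = {z. z ^ p = 1}"
  proof (rule card_subset_eq)
    \<comment> \<open>The cardinality \<open>p\<close> is positive, whereas \<open>card\<close> is 0
      on infinite sets.\<close>
    show "finite {z :: 'a. z ^ p = 1}"
      by (rule card_ge_0_finite) (simp add: card prime_gt_0_nat[OF p])
    show "(\<lambda>n. u ^ n) ` {..<p} \<subseteq> {z. z ^ p = 1}"
    proof safe
      fix n
      have "(u ^ n) ^ p = (u ^ p) ^ n" by (simp flip: power_mult add: mult.commute)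
      then show "(u ^ n) ^ p = 1" by (simp add: u(1))
    qed
    show "card ((\<lambda>n. u ^ n) ` {..<p}) = card {z :: 'a. z ^ p = 1}"
      by (simp add: card_image[OF inj] card)
  qed
  then show ?thesis using v by blast
qed

context
  fixes p :: nat assumes p: "prime p"
begin

lemma mod_group_carrier: "carrier (integer_mod_group p) = {0..<int p}"
  using prime_gt_0_nat[OF p] by (simp add: carrier_integer_mod_group)

lemma one_in_mod_group: "1 \<in> carrier (integer_mod_group p)"
  using prime_gt_1_nat[OF p] by (simp add: mod_group_carrier)

lemma mod_in_mod_group: "x mod int p \<in> carrier (integer_mod_group p)"
  using prime_gt_0_nat[OF p] by (simp add: mod_group_carrier)

lemma character_mult:
  assumes "chi \<in> characters p" "x \<in> carrier (integer_mod_group p)" "y \<in> carrier (integer_mod_group p)"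
  shows "chi ((x + y) mod int p) = chi x * chi y"
  using assms by (auto simp: characters_def Kunits_def hom_def)

lemma character_nonzero:
  "chi \<in> characters p \<Longrightarrow> x \<in> carrier (integer_mod_group p) \<Longrightarrow> chi x \<noteq> 0"
  by (auto simp: characters_def Kunits_def hom_def Pi_iff)

lemma character_0: "chi \<in> characters p \<Longrightarrow> chi 0 = 1"
  using character_mult[of chi 0 0] character_nonzero[of chi 0] by simp

text \<open>The element \<open>1\<close> generates the group; the induction stays below
  \<open>p\<close>, where adding \<open>1\<close> needs no reduction.\<close>

lemma character_eq_power:
  assumes "chi \<in> characters p" "x \<in> carrier (integer_mod_group p)"
  shows "chi x = chi 1 ^ nat x"
proof -
  have "chi (int n) = chi 1 ^ n" if "n < p" for n
    using that
  proof (induction n)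
    case 0
    then show ?case using character_0[OF assms(1)] by simp
  next
    case (Suc n)
    then have "chi ((int n + 1) mod int p) = chi (int n) * chi 1"
      by (intro character_mult[OF assms(1)] one_in_mod_group) (simp add: mod_group_carrier)
    then show ?case using Suc by (simp add: add.commute mult.commute)
  qed
  from this[of "nat x"] show ?thesis using assms(2) by (simp add: mod_group_carrier nat_less_iff)
qed

lemma character_power_p:
  assumes "chi \<in> characters p"
  shows "chi 1 ^ p = 1"
proof -
  have p1: "p > 1" using prime_gt_1_nat[OF p] .
  \<comment> \<open>Adding \<open>1\<close> to \<open>p - 1\<close> wraps around to 0, where the
    character is 1.\<close>
  have "chi ((int (p - 1) + 1) mod int p) = chi (int (p - 1)) * chi 1"
    using p1 by (intro character_mult[OF assms] one_in_mod_group) (simp add: mod_group_carrier)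
  moreover have "chi (int (p - 1)) = chi 1 ^ (p - 1)"
    using p1 character_eq_power[OF assms, of "int (p - 1)"]
    by (simp add: mod_group_carrier del: of_nat_diff)
  ultimately have "chi 0 = chi 1 ^ (p - 1) * chi 1" using p1 by (simp add: of_nat_diff)
  also have "\<dots> = chi 1 ^ p" using p1 by (simp flip: power_Suc2)
  finally show ?thesis using character_0[OF assms] by simp
qed

lemma character_eqI:
  assumes "chi \<in> characters p" "chi' \<in> characters p" "chi 1 = chi' 1"
  shows "chi = chi'"
proof (rule extensionalityI)
  show "chi \<in> extensional (carrier (integer_mod_group p))"
    "chi' \<in> extensional (carrier (integer_mod_group p))"
    using assms by (simp_all add: characters_def)
  show "chi x = chi' x" if "x \<in> carrier (integer_mod_group p)" for x
    using character_eq_power[OF assms(1) that] character_eq_power[OF assms(2) that] assms(3) by simp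
qed

lemma trivial_character_in_characters: "trivial_character p \<in> characters p"
  by (auto simp: trivial_character_def characters_def hom_def Kunits_def mod_in_mod_group)

lemma nontrivial_character_1:
  assumes "chi \<in> characters p" "chi \<noteq> trivial_character p"
  shows "chi 1 \<noteq> 1"
proof -
  have "trivial_character p 1 = 1" using one_in_mod_group by (simp add: trivial_character_def)
  then show ?thesis
    using character_eqI[OF assms(1) trivial_character_in_characters] assms(2) by auto
qed

text \<open>At \<open>g\<close> the product of the two powers is the \<open>g\<close>-th power of
  its value at the generator, so the condition at \<open>1\<close> implies all the others. It says
  \<open>?u powi (x + int b * y) = 1\<close>, where \<open>?u\<close> has order
  \<open>p\<close>.\<close>

lemma lattice_L_eq:
  assumes chi: "chi1 \<in> characters p" "chi1 \<noteq> trivial_character p" "chi2 \<in> characters p"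
    and b: "chi2 1 = chi1 1 ^ b"
  shows "lattice_L p chi1 chi2 = {(x, y). int p dvd x + int b * y}"
proof -
  let ?u = "chi1 1"
  have u: "?u ^ p = 1" "?u \<noteq> 1" "?u \<noteq> 0"
    by (rule character_power_p[OF chi(1)], rule nontrivial_character_1[OF chi(1,2)],
        rule character_nonzero[OF chi(1) one_in_mod_group])
  have eq: "chi1 g powi x * chi2 g powi y = (?u powi (x + int b * y)) ^ nat g"
    if "g \<in> carrier (integer_mod_group p)" for x y g
  proof -
    have "chi1 g powi x = (?u powi x) ^ nat g"
      by (simp add: character_eq_power[OF chi(1) that] mult.commute
          flip: power_int_of_nat power_int_mult)
    moreover have "chi2 g powi y = (?u powi (int b * y)) ^ nat g"
      by (simp add: character_eq_power[OF chi(3) that] b mult_ac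
          flip: power_int_of_nat power_int_mult)
    ultimately show ?thesis using u(3) by (simp add: power_int_add power_mult_distrib)
  qed
  have "(\<forall>g\<in>carrier (integer_mod_group p). chi1 g powi x * chi2 g powi y = 1) \<longleftrightarrow>
      ?u powi (x + int b * y) = 1" for x y
  proof
    assume "\<forall>g\<in>carrier (integer_mod_group p). chi1 g powi x * chi2 g powi y = 1"
    then show "?u powi (x + int b * y) = 1"
      using eq[OF one_in_mod_group, of x y] one_in_mod_group by simp
  qed (simp add: eq)
  then show ?thesis
    by (simp add: lattice_L_def power_int_eq_1_iff[OF p u(1,2)])
qed

section \<open>Representations of the cyclic group and their duals\<close>

lemma representation_mult:
  assumes "is_representation p \<rho>" "x \<in> carrier (integer_mod_group p)" "y \<in> carrier (integer_mod_group p)"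
  shows "\<rho> ((x + y) mod int p) = \<rho> x ** \<rho> y"
  using assms by (auto simp: is_representation_def GL_def hom_def)

lemma representation_0:
  assumes "is_representation p \<rho>"
  shows "\<rho> 0 = mat 1"
proof -
  have "invertible (\<rho> 0)"
    using assms by (auto simp: is_representation_def GL_def hom_def Pi_iff)
  then obtain B where "B ** \<rho> 0 = mat 1" by (auto simp: invertible_def)
  moreover have "\<rho> 0 = \<rho> 0 ** \<rho> 0" using representation_mult[OF assms, of 0 0] by simp
  ultimately show ?thesis by (metis matrix_mul_assoc matrix_mul_lid)
qed

end

text \<open>The matrix \<open>A - mat c\<close> and its transpose are singular together.\<close>

lemma eigenvector_transpose:
  fixes A :: "'a::field ^ 'n ^ 'n"
  assumes "A *v v = c *s v" "v \<noteq> 0"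
  obtains w where "w \<noteq> 0" "transpose A *v w = c *s w"
proof -
  have shift: "(X - mat c) *v x = 0 \<longleftrightarrow> X *v x = c *s x" for X :: "'a ^ 'n ^ 'n" and x
  proof -
    have "mat c *v x = c *s x"
      by (simp add: vec_eq_iff mat_def matrix_vector_mult_def if_distrib[of "\<lambda>z. z * _"] cong: if_cong)
    then show ?thesis by (simp add: matrix_vector_mult_diff_rdistrib)
  qed
  let ?B = "A - mat c"
  have "\<nexists>C. C ** ?B = mat 1"
    using assms shift[of A v] unfolding matrix_left_invertible_ker by blast
  then have "\<nexists>C. C ** transpose ?B = mat 1"
    unfolding left_invertible_transpose using matrix_left_right_inverse[of ?B] by blast
  then obtain w where w: "w \<noteq> 0" "transpose ?B *v w = 0"
    unfolding matrix_left_invertible_ker by blast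
  have "transpose ?B = transpose A - mat c"
    by (auto simp: vec_eq_iff transpose_def mat_def)
  then show thesis using that w shift[of "transpose A" w] by simp
qed

text \<open>If a character occurs in V, its inverse occurs in the dual, and inversion is injective.
  The estimate transfers the count of characters in V to \<open>Supp'\<close>, where it shows that
  \<open>chi1\<close> and \<open>chi2\<close> differ.\<close>

lemma card_nontrivial_characters_le_card_Supp':
  fixes \<rho> :: "int \<Rightarrow> 'k::field ^ 'n ^ 'n" and \<iota> :: "'k \<Rightarrow> 'K::field"
  assumes p: "prime p" and rep: "is_representation p \<rho>" and emb: "field_embedding \<iota>"
    and fin: "finite (Supp' p \<iota> \<rho>)"
  shows "card (nontrivial_characters_in p \<iota> \<rho>) \<le> card (Supp' p \<iota> \<rho>)"
proof (rule card_inj_on_le[OF _ _ fin])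
  interpret field_extension \<iota> using emb by unfold_locales
  let ?G = "carrier (integer_mod_group p)"
  let ?inv = "\<lambda>chi :: int \<Rightarrow> 'K. \<lambda>g\<in>?G. chi ((- g) mod int p)"
  note carrier = mod_group_carrier[OF p] and in_G = mod_in_mod_group[OF p] and one = one_in_mod_group[OF p]
  have inv_inv: "?inv chi ((- g) mod int p) = chi g" if "g \<in> ?G" for chi g
    using that in_G by (simp add: mod_minus_eq carrier)
  show "inj_on ?inv (nontrivial_characters_in p \<iota> \<rho>)"
  proof (rule inj_onI)
    fix chi chi'
    assume chi: "chi \<in> nontrivial_characters_in p \<iota> \<rho>" "chi' \<in> nontrivial_characters_in p \<iota> \<rho>"
      and eq: "?inv chi = ?inv chi'"
    have "chi g = chi' g" if "g \<in> ?G" for g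
    proof -
      have "chi g = ?inv chi ((- g) mod int p)" by (rule inv_inv[OF that, symmetric])
      also have "\<dots> = ?inv chi' ((- g) mod int p)" by (simp only: eq)
      also have "\<dots> = chi' g" by (rule inv_inv[OF that])
      finally show ?thesis .
    qed
    then show "chi = chi'"
      using chi one by (intro character_eqI[OF p]) (simp_all add: nontrivial_characters_in_def)
  qed
  show "?inv ` nontrivial_characters_in p \<iota> \<rho> \<subseteq> Supp' p \<iota> \<rho>"
  proof safe
    fix chi assume "chi \<in> nontrivial_characters_in p \<iota> \<rho>"
    then have chi: "chi \<in> characters p" "chi \<noteq> trivial_character p" and "occurs p \<iota> \<rho> chi"
      by (auto simp: nontrivial_characters_in_def)
    then obtain v where v: "v \<noteq> 0" "\<And>g. g \<in> ?G \<Longrightarrow> map_matrix \<iota> (\<rho> g) *v v = chi g *s v"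
      unfolding occurs_def by blast
    obtain w where w: "w \<noteq> 0" "transpose (map_matrix \<iota> (\<rho> 1)) *v w = chi 1 *s w"
      using eigenvector_transpose[OF v(2)[OF one] v(1)] .
    \<comment> \<open>The vector \<open>w\<close> was obtained for the generator only; induction
      over the multiples of \<open>1\<close> makes it a simultaneous eigenvector.\<close>
    have "transpose (map_matrix \<iota> (\<rho> (int n))) *v w = chi (int n) *s w" if "n < p" for n
      using that
    proof (induction n)
      case 0
      then show ?case
        by (simp add: representation_0[OF p rep] map_matrix_emb_mat_1 transpose_mat character_0[OF p chi(1)])
    next
      case (Suc n)
      then have n: "int n \<in> ?G" "(int n + 1) mod int p = int (Suc n)" by (simp_all add: carrier)
      have "\<rho> (int (Suc n)) = \<rho> (int n) ** \<rho> 1"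
        using representation_mult[OF p rep n(1) one] n(2) by simp
      moreover have "chi (int (Suc n)) = chi (int n) * chi 1"
        using character_mult[OF p chi(1) n(1) one] n(2) by simp
      ultimately show ?case
        using Suc by (simp add: map_matrix_emb_mult matrix_transpose_mul w(2) vector_scalar_commute
            del: transpose_matrix_vector
            add: vector_smult_assoc mult.commute flip: matrix_vector_mul_assoc)
    qed
    note power = this
    have all: "transpose (map_matrix \<iota> (\<rho> g)) *v w = chi g *s w" if "g \<in> ?G" for g
      using power[of "nat g"] that by (simp add: carrier nat_less_iff)
    have "map_matrix \<iota> (transpose A) = transpose (map_matrix \<iota> A)" for A :: "'k ^ 'n ^ 'n"
      by (simp add: vec_eq_iff transpose_def)
    \<comment> \<open>The dual uses the transpose at the inverse element, so \<open>g\<close> acts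
      on \<open>w\<close> by the value of \<open>chi\<close> at \<open>- g\<close>.\<close>
    then have "occurs p \<iota> (dual_rep p \<rho>) (?inv chi)"
      unfolding occurs_def using w(1) all[OF in_G]
      by (intro exI[of _ w]) (simp add: dual_rep_def)
    moreover have "?inv chi \<in> characters p"
    proof -
      have "chi (- ((x + y) mod int p) mod int p) = chi (- x mod int p) * chi (- y mod int p)" for x y
        using character_mult[OF p chi(1) in_G in_G, of "- x" "- y"]
        by (simp add: mod_add_eq mod_minus_eq)
      then show ?thesis
        by (simp add: characters_def hom_def Kunits_def in_G character_nonzero[OF p chi(1) in_G])
    qed
    moreover have "?inv chi \<noteq> trivial_character p"
    proof
      assume triv: "?inv chi = trivial_character p"
      have "chi 1 = trivial_character p ((- 1) mod int p)"
        using inv_inv[OF one, of chi] unfolding triv by (rule sym)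
      then have "chi 1 = 1" using in_G[of "- 1"] by (simp only: trivial_character_def restrict_apply')
      then show False using nontrivial_character_1[OF p chi] by simp
    qed
    ultimately show "?inv chi \<in> Supp' p \<iota> \<rho>"
      by (simp add: Supp'_def nontrivial_characters_in_def)
  qed
qed

section \<open>The Hilbert series\<close>

lemma hilbert_series_invariants:
  fixes \<rho> :: "int \<Rightarrow> 'k::field ^ 'n ^ 'n" and \<iota> :: "'k \<Rightarrow> 'K::field"
  assumes p: "prime p" and emb: "field_embedding \<iota>"
    and n: "CARD('n) = 2"
    and Supp: "chi1 \<in> Supp' p \<iota> \<rho>" "chi2 \<in> Supp' p \<iota> \<rho>" "chi1 \<noteq> chi2"
  shows "hilbert_series (invariant_ring p \<rho>) =
    degree_series {a. (int (fst a), int (snd a)) \<in> lattice_L p chi1 chi2}"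
proof -
  interpret field_extension \<iota> using emb by unfold_locales
  let ?G = "carrier (integer_mod_group p)"
  note one = one_in_mod_group[OF p]
  obtain i1 i2 :: 'n where i: "UNIV = {i1, i2}" "i1 \<noteq> i2"
    using n by (auto simp: card_2_iff)
  have sum_i: "sum h UNIV = h i1 + h i2" for h :: "'n \<Rightarrow> 'b::comm_monoid_add"
    unfolding i(1) using i(2) by simp
  \<comment> \<open>Substituting \<open>M g\<close> is the action of \<open>g\<close> after base
    change, and the transpose of \<open>M g\<close> is the matrix of \<open>g\<close> on the dual.
    Eigenvectors of the dual are thus linear forms that the substitution multiplies by a
    character.\<close>
  define M where "M g = map_matrix \<iota> (\<rho> (inv\<^bsub>integer_mod_group p\<^esub> g))" for g
  have "map_matrix \<iota> (dual_rep p \<rho> g) = transpose (M g)" for g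
    by (simp add: vec_eq_iff transpose_def dual_rep_def M_def)
  then have ev: "\<exists>v. v \<noteq> 0 \<and> (\<forall>g\<in>?G. transpose (M g) *v v = chi g *s v)"
    if "chi \<in> Supp' p \<iota> \<rho>" for chi
    using that by (auto simp: Supp'_def nontrivial_characters_in_def occurs_def)
  obtain v1 where v1: "v1 \<noteq> 0" "\<And>g. g \<in> ?G \<Longrightarrow> transpose (M g) *v v1 = chi1 g *s v1"
    using ev[OF Supp(1)] by blast
  obtain v2 where v2: "v2 \<noteq> 0" "\<And>g. g \<in> ?G \<Longrightarrow> transpose (M g) *v v2 = chi2 g *s v2"
    using ev[OF Supp(2)] by blast
  have chi_1: "chi1 1 \<noteq> chi2 1"
    using Supp character_eqI[OF p, of chi1 chi2] by (auto simp: Supp'_def nontrivial_characters_in_def)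
  \<comment> \<open>The two eigenvectors become the rows of \<open>Q\<close>, that is, the
    coordinates in which the action is diagonal.\<close>
  define Q where "Q = (\<chi> i. if i = i1 then v1 else v2)"
  define D :: "int \<Rightarrow> 'K ^ 'n ^ 'n"
    where "D g = (\<chi> i j. if i = j then (if i = i1 then chi1 g else chi2 g) else 0)" for g
  have "\<exists>Q'. Q ** Q' = mat 1"
    unfolding matrix_right_invertible_independent_rows
  proof (intro allI impI)
    fix c i assume "(\<Sum>i\<in>UNIV. c i *s row i Q) = 0"
    moreover have "row i1 Q = v1" "row i2 Q = v2" using i(2) by (simp_all add: Q_def row_def vec_eq_iff)
    ultimately have c: "c i1 *s v1 + c i2 *s v2 = 0" by (simp add: sum_i)
    then have "transpose (M 1) *v (c i1 *s v1 + c i2 *s v2) = 0" by simp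
    then have "c i1 *s (chi1 1 *s v1) + c i2 *s (chi2 1 *s v2) = 0"
      using v1(2)[OF one] v2(2)[OF one] by (simp add: matrix_vector_right_distrib vector_scalar_commute)
    \<comment> \<open>Independence of eigenvectors for distinct eigenvalues: subtracting
      \<open>chi2 1\<close> times the first relation from the second eliminates
      \<open>v2\<close>.\<close>
    then have "(chi1 1 - chi2 1) * c i1 * v1 $ j = 0" for j
    proof -
      have "c i1 * v1 $ j + c i2 * v2 $ j = 0"
        "c i1 * (chi1 1 * v1 $ j) + c i2 * (chi2 1 * v2 $ j) = 0"
        using c \<open>c i1 *s (chi1 1 *s v1) + c i2 *s (chi2 1 *s v2) = 0\<close> by (simp_all add: vec_eq_iff mult.assoc)
      then show ?thesis by algebra
    qed
    then have 1: "c i1 = 0" using v1(1) chi_1 by (auto simp: vec_eq_iff)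
    then have "c i2 = 0" using c v2(1) by (auto simp: vec_eq_iff)
    moreover have "i = i1 \<or> i = i2" using i(1) by blast
    ultimately show "c i = 0" using 1 by blast
  qed
  then obtain Q' where Q': "Q ** Q' = mat 1" "Q' ** Q = mat 1"
    using matrix_left_right_inverse by blast
  have diag: "Q ** M g = D g ** Q" if "g \<in> ?G" for g
  proof -
    have "(Q ** M g) $ i $ j = (D g ** Q) $ i $ j" for i j
    proof -
      have "(Q ** M g) $ i $ j = (transpose (M g) *v (Q $ i)) $ j"
        by (simp add: matrix_matrix_mult_def matrix_vector_mult_def transpose_def mult.commute)
      also have "\<dots> = D g $ i $ i * Q $ i $ j"
        by (simp add: Q_def D_def v1(2)[OF that] v2(2)[OF that] del: transpose_matrix_vector)
      also have "\<dots> = (\<Sum>k\<in>UNIV. if k = i then D g $ i $ i * Q $ i $ j else 0)" by simp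
      also have "\<dots> = (\<Sum>k\<in>UNIV. D g $ i $ k * Q $ k $ j)"
        by (intro sum.cong) (auto simp: D_def)
      also have "\<dots> = (D g ** Q) $ i $ j" by (simp add: matrix_matrix_mult_def)
      finally show ?thesis .
    qed
    then show ?thesis by (simp add: vec_eq_iff)
  qed
  have D: "D g $ i $ j = 0" if "i \<noteq> j" for g i j using that by (simp add: D_def)
  have "vector_space.dim scale_poly (invariant_ring p \<rho> \<inter> homogeneous d) =
    card {a \<in> {a. (int (fst a), int (snd a)) \<in> lattice_L p chi1 chi2}. fst a + snd a = d}" for d
  proof -
    \<comment> \<open>Invariance under a set of matrices over \<open>'k\<close> is the form in which
      the dimension is compared with that over \<open>'K\<close>.\<close>
    let ?A = "(\<lambda>g. \<rho> (inv\<^bsub>integer_mod_group p\<^esub> g)) ` ?G"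
    let ?P = "\<lambda>x y. x + y = d \<and> (\<forall>g\<in>?G. chi1 g ^ x * chi2 g ^ y = 1)"
    have "invariant_ring p \<rho> \<inter> homogeneous d = {f \<in> homogeneous d. \<forall>A\<in>?A. subst_linear A f = f}"
      by (auto simp: invariant_ring_def poly_action_def)
    then have "vector_space.dim scale_poly (invariant_ring p \<rho> \<inter> homogeneous d) =
      vector_space.dim scale_poly {f \<in> homogeneous d. \<forall>A\<in>?A. subst_linear (map_matrix \<iota> A) f = f}"
      by (simp only: dim_base_change_invariants)
    also have "\<dots> = vector_space.dim scale_poly {f \<in> homogeneous d. \<forall>g\<in>?G. subst_linear (M g) f = f}"
      by (simp only: M_def ball_simps)
    also have "\<dots> = card {m :: 'n \<Rightarrow>\<^sub>0 nat. (\<Sum>i\<in>UNIV. Poly_Mapping.lookup m i) = d \<and>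
      (\<forall>g\<in>?G. (\<Prod>i\<in>UNIV. D g $ i $ i ^ Poly_Mapping.lookup m i) = 1)}"
      by (rule dim_invariants_diagonalizable[OF Q' diag D])
    also have "\<dots> = card {m :: 'n \<Rightarrow>\<^sub>0 nat. ?P (Poly_Mapping.lookup m i1) (Poly_Mapping.lookup m i2)}"
    proof -
      have "(\<Prod>i\<in>UNIV. D g $ i $ i ^ Poly_Mapping.lookup m i) =
        chi1 g ^ Poly_Mapping.lookup m i1 * chi2 g ^ Poly_Mapping.lookup m i2" for g m
        unfolding i(1) using i(2) by (simp add: D_def)
      then show ?thesis by (simp add: sum_i)
    qed
    also have "\<dots> = card {a. ?P (fst a) (snd a)}" by (rule card_exponents_2[OF i])
    also have "{a. ?P (fst a) (snd a)} =
      {a \<in> {a. (int (fst a), int (snd a)) \<in> lattice_L p chi1 chi2}. fst a + snd a = d}"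
      by (auto simp: lattice_L_def power_int_of_nat)
    finally show ?thesis .
  qed
  then show ?thesis by (simp add: hilbert_series_def degree_series_def)
qed

text \<open>Periodicity reduces the series to the box, and distinctness of degrees there turns the
  numerator into a sum of distinct powers.\<close>

lemma degree_series_cyclic_lattice:
  fixes p :: nat and b :: int
  defines "T \<equiv> cyclic_lattice p b \<inter> box_T p"
  assumes inj: "inj_on point_deg T" and p: "p > 0"
  shows "degree_series {a. (int (fst a), int (snd a)) \<in> cyclic_lattice p b} =
    (1 + (\<Sum>d\<in>point_deg ` T - {0}. fps_X ^ nat d)) / (1 - fps_X ^ p) ^ 2"
proof -
  let ?S = "{a. (int (fst a), int (snd a)) \<in> cyclic_lattice p b}"
  \<comment> \<open>The natural-number copy of \<open>T\<close>, a fundamental domain for the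
    translations by \<open>(p, 0)\<close> and \<open>(0, p)\<close>.\<close>
  let ?U = "{(x, y) \<in> ?S. x < p \<and> y < p}"
  have T: "T = (\<lambda>a. (int (fst a), int (snd a))) ` ?U"
  proof -
    have "(x, y) \<in> (\<lambda>a. (int (fst a), int (snd a))) ` ?U" if "(x, y) \<in> T" for x y
      by (rule image_eqI[of _ _ "(nat x, nat y)"]) (use that in \<open>auto simp: T_def box_T_def nat_less_iff\<close>)
    then show ?thesis by (auto simp: T_def box_T_def)
  qed
  have deg: "fst a + snd a = nat (point_deg (int (fst a), int (snd a)))" for a
    by (simp add: point_deg_def nat_add_distrib)
  have nonneg: "0 \<le> d" if "d \<in> point_deg ` T" for d
    using that by (auto simp: T_def box_T_def point_deg_def)
  have "inj_on (\<lambda>a. fst a + snd a) ?U"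
  proof (rule inj_onI)
    fix a c assume ac: "a \<in> ?U" "c \<in> ?U" "fst a + snd a = fst c + snd c"
    have "(int (fst a), int (snd a)) = (int (fst c), int (snd c))"
    proof (rule inj_onD[OF inj])
      show "point_deg (int (fst a), int (snd a)) = point_deg (int (fst c), int (snd c))"
        using ac(3) by (simp add: point_deg_def flip: of_nat_add)
      show "(int (fst a), int (snd a)) \<in> T" unfolding T using ac(1) by (rule imageI)
      show "(int (fst c), int (snd c)) \<in> T" unfolding T using ac(2) by (rule imageI)
    qed
    then show "a = c" by (simp add: prod_eq_iff)
  qed
  moreover have "finite ?U" by (rule finite_subset[of _ "{..<p} \<times> {..<p}"]) auto
  ultimately have "degree_series ?U = (\<Sum>d\<in>(\<lambda>a. fst a + snd a) ` ?U. fps_X ^ d)"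
    by (rule degree_series_inj_on[rotated])
  also have "(\<lambda>a. fst a + snd a) ` ?U = nat ` point_deg ` T"
    unfolding T image_image deg ..
  also have "(\<Sum>d\<in>nat ` point_deg ` T. fps_X ^ d) = (\<Sum>d\<in>point_deg ` T. fps_X ^ nat d :: rat fps)"
  proof (rule sum.reindex_cong[of nat])
    show "inj_on nat (point_deg ` T)"
      by (rule inj_onI) (simp only: eq_nat_nat_iff nonneg)
  qed simp_all
  \<comment> \<open>The summand 1 is the contribution of the origin.\<close>
  also have "\<dots> = 1 + (\<Sum>d\<in>point_deg ` T - {0}. fps_X ^ nat d)"
  proof -
    have "finite T" unfolding T using \<open>finite ?U\<close> by simp
    moreover have "0 \<in> point_deg ` T"
      by (rule image_eqI[of _ _ "(0, 0)"])
        (use p in \<open>auto simp: point_deg_def T_def box_T_def cyclic_lattice_def\<close>)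
    ultimately show ?thesis by (subst sum.remove[of _ 0]) auto
  qed
  finally have "degree_series ?U = 1 + (\<Sum>d\<in>point_deg ` T - {0}. fps_X ^ nat d)" .
  moreover have "degree_series ?U = degree_series ?S * (1 - fps_X ^ p) ^ 2"
  proof (rule degree_series_periodic)
    fix x y :: nat
    have "int (x + p) + b * int y = (int x + b * int y) + 1 * int p"
      "int x + b * int (y + p) = (int x + b * int y) + b * int p"
      by (simp_all add: algebra_simps)
    then show "(x + p, y) \<in> ?S \<longleftrightarrow> (x, y) \<in> ?S" "(x, y + p) \<in> ?S \<longleftrightarrow> (x, y) \<in> ?S"
      unfolding cyclic_lattice_def by (simp_all only: mem_Collect_eq fst_conv snd_conv prod.case
          dvd_add_times_triv_right_iff)
  qed
  \<comment> \<open>The constant coefficient of \<open>1 - fps_X ^ p\<close> is 1 because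
    \<open>p > 0\<close>, so the denominator can be cancelled.\<close>
  moreover have "(1 - fps_X ^ p :: rat fps) ^ 2 \<noteq> 0"
  proof -
    have "fps_nth (1 - fps_X ^ p :: rat fps) 0 \<noteq> fps_nth 0 0" using p by simp
    then have "(1 - fps_X ^ p :: rat fps) \<noteq> 0" by metis
    then show ?thesis by simp
  qed
  ultimately show ?thesis
    using nonzero_mult_div_cancel_right[of "(1 - fps_X ^ p :: rat fps) ^ 2" "degree_series ?S"] by simp
qed

theorem proposition4p5:
  fixes p :: nat
    and \<rho> :: "int \<Rightarrow> 'k::field ^ 'n ^ 'n"
    and \<iota> :: "'k \<Rightarrow> 'K::field"
    and chi1 chi2 :: "int \<Rightarrow> 'K"
    and D :: "int set"
  assumes "prime p" and "odd p"
    and "CHAR('k) \<noteq> p"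
    and "is_representation p \<rho>"
    and "field_embedding \<iota>"
    and "card {z :: 'K. z ^ p = 1} = p"
    and "card (nontrivial_characters_in p \<iota> \<rho>) = 2"
    and "Supp' p \<iota> \<rho> = {chi1, chi2}"
    and "D = nonzero_degrees p chi1 chi2"
  shows "inj_on point_deg (lattice_L p chi1 chi2 \<inter> box_T p)
    \<and> D \<subseteq> {2..2 * int p - 2}
    \<and> (\<forall>d\<in>D. 2 * int p - d \<in> D)
    \<and> (\<forall>r\<in>{1..<int p}. \<exists>!d. d \<in> D \<and> [d = r] (mod int p))
    \<and> int p \<notin> D
    \<and> (\<forall>d\<in>D. \<not> (\<exists>e\<in>D. [e = int p] (mod d)))
    \<and> (CARD('n) = 2 \<longrightarrow>
         hilbert_series (invariant_ring p \<rho>) =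
           (1 + (\<Sum>d\<in>D. fps_X ^ nat d)) / (1 - fps_X ^ p) ^ 2)"
proof -
  note p = \<open>prime p\<close>
  have Supp: "chi1 \<in> Supp' p \<iota> \<rho>" "chi2 \<in> Supp' p \<iota> \<rho>" using assms(8) by simp_all
  then have chi: "chi1 \<in> characters p" "chi1 \<noteq> trivial_character p"
    "chi2 \<in> characters p" "chi2 \<noteq> trivial_character p"
    by (auto simp: Supp'_def nontrivial_characters_in_def)
  \<comment> \<open>As a set, \<open>{chi1, chi2}\<close> could be a singleton; the two characters
    of V exclude this.\<close>
  have "2 \<le> card {chi1, chi2}"
    using card_nontrivial_characters_le_card_Supp'[OF p assms(4,5)] assms(7,8) by simp
  then have neq: "chi1 \<noteq> chi2" by auto
  note u = character_power_p[OF p chi(1)] nontrivial_character_1[OF p chi(1,2)]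
  note v = character_power_p[OF p chi(3)] nontrivial_character_1[OF p chi(3,4)]
  \<comment> \<open>The value \<open>chi1 1\<close> is a nontrivial \<open>p\<close>-th root of
    unity, and its powers exhaust the \<open>p\<close>-th roots of unity in
    \<open>'K\<close>.\<close>
  obtain b where b: "chi2 1 = chi1 1 ^ b"
    using root_of_unity_eq_power[OF p assms(6) u v(1)] by blast
  have L: "lattice_L p chi1 chi2 = cyclic_lattice p (int b)"
    using lattice_L_eq[OF p chi(1-3) b] by (simp add: cyclic_lattice_def)
  \<comment> \<open>With \<open>b\<close> congruent to 0 the character \<open>chi2\<close> would be
    trivial; with \<open>b\<close> congruent to 1 it would equal \<open>chi1\<close>.\<close>
  have b1: "\<not> int p dvd int b"
    using v(2) power_int_eq_1_iff[OF p u, of "int b"] b by (simp add: power_int_of_nat)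
  have b2: "\<not> int p dvd 1 - int b"
  proof
    assume "int p dvd 1 - int b"
    then have "chi1 1 powi (1 - int b) = 1" using power_int_eq_1_iff[OF p u] by blast
    then have "chi1 1 = chi2 1"
      using character_nonzero[OF p chi(1) one_in_mod_group[OF p]] b by (simp add: power_int_diff power_int_of_nat)
    then show False using neq character_eqI[OF p chi(1,3)] by simp
  qed
  have D: "D = point_deg ` (cyclic_lattice p (int b) \<inter> box_T p) - {0}"
    by (simp add: assms(9) nonzero_degrees_def L)
  note degrees = cyclic_lattice_degrees[OF p b1 b2, folded D]
  have "hilbert_series (invariant_ring p \<rho>) =
      (1 + (\<Sum>d\<in>D. fps_X ^ nat d)) / (1 - fps_X ^ p) ^ 2" if "CARD('n) = 2"
    using hilbert_series_invariants[OF p assms(5) that Supp neq]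
      degree_series_cyclic_lattice[OF degrees(1) prime_gt_0_nat[OF p]]
    by (simp only: L D)
  moreover have "\<not> (\<exists>e\<in>D. [e = int p] (mod d))" if "d \<in> D" for d
    using degrees(6)[OF that] by blast
  ultimately show ?thesis
    unfolding L using degrees(1-5) by (intro conjI ballI impI)
qed

end
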